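(* Let $q$ be a positive integer. For an integral ideal $\mathfrak{b}$ of a real quadratic field $K$, relatively prime to $q$ and with $\mathfrak{b}^{-1}=[1,\delta]$, and a ray class character $\chi$ modulo $q$, we have $$L_K(s,\chi,\mathfrak{b})=\sum_{(C,D)\in\tilde{F}'_{\delta}}\chi((C+D\delta)\mathfrak{b})\,\zeta_q(s,(C+D\delta)\mathfrak{b}).$$
   Context: Here $[1,\delta]=\mathbb{Z}+\mathbb{Z}\delta$, and the superscript $^+$ denotes totally positive elements. $E^+$ is the group of totally positive units of $K$, and $E_q^+$ is the multiplicative group of totally positive units congruent to $1$ modulo $q$. The partial zeta function of the ray class of an ideal $\mathfrak{a}$ of $K$ is $\zeta_q(s,\mathfrak{a})=\sum_{\mathfrak{c}\sim_q\mathfrak{a}}N(\mathfrak{c})^{-s}$, the sum over integral ideals $\mathfrak{c}$ with $\mathfrak{c}\sim_q\mathfrak{a}$, where $\mathfrak{c}\sim_q\mathfrak{a}$ means $\mathfrak{c}=(\alpha)\mathfrak{a}$ for a totally positive $\alpha\equiv1\pmod q$; equivalently $\zeta_q(s,\mathfrak{a})=\sum_{\alpha\in(1+q\mathfrak{a}^{-1})^+/E_q^+}N(\mathfrak{a}\alpha)^{-s}$. The partial Hecke $L$-function associated to $(\mathfrak{b},\chi)$ is $L_K(s,\chi,\mathfrak{b})=\sum_{\mathfrak{c}\sim\mathfrak{b}}\chi(\mathfrak{c})N(\mathfrak{c})^{-s}$, where the summation runs over every integral ideal $\mathfrak{c}$ principally equivalent to $\mathfrak{b}$ (that is, differing from $\mathfrak{b}$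 by a principal fractional ideal). The character $\chi$ takes the value $0$ on integral ideals not relatively prime to $q$. Let $F=\{(C,D)\in\mathbb{Z}^2 : 0\le C,D\le q-1,\ (C,D)\ne(0,0)\}$ and let $F_\delta=\{(C,D)\in\mathbb{Z}^2 : 0\le C,D\le q-1,\ ((C+D\delta)\mathfrak{b},q)=1\}$, regarded as a subset of $F$. The group $E^+$ acts on $F$ by $\epsilon\ast(C+D\delta)=C'+D'\delta$, where $(C+D\delta)\epsilon+q\mathfrak{b}^{-1}=C'+D'\delta+q\mathfrak{b}^{-1}$ (identifying $(C,D)$ with $C+D\delta$), and this action is inherited by $F_\delta$. $\tilde{F}'\subset F$ is a fundamental set for the quotient $F/E^+$, and $\tilde{F}'_\delta\subset\tilde{F}'$ is a fundamental set for the quotient $F_\delta/E^+$.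
   Formalization: Proved for Re s > 1, q > 1 and δ totally positive; the sum L_K over the wide class of b is treated only when K has a unit of norm −1, and otherwise c runs over (α)b with α totally positive. Without these changes the identity fails. *)

theory Defs
  imports
    "HOL-Analysis.Analysis"
    "HOL-Computational_Algebra.Computational_Algebra"
begin

text \<open>
  A real quadratic field is represented as the subfield \<open>\<rat>(\<surd>d)\<close> of the reals, for a squarefree
  \<open>d > 1\<close>; ideals and fractional ideals are sets of real numbers.
\<close>

definition quad_field :: "nat \<Rightarrow> real set" where
  "quad_field d = {a + b * sqrt (real d) | a b. a \<in> \<rat> \<and> b \<in> \<rat>}"

definition quad_conj :: "nat \<Rightarrow> real \<Rightarrow> real" where
  "quad_conj d x =
     (THE y. \<exists>a\<in>\<rat>. \<exists>b\<in>\<rat>. x = a + b * sqrt (real d) \<and> y = a - b * sqrt (real d))"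

definition ring_of_integers :: "nat \<Rightarrow> real set" where
  "ring_of_integers d = {x \<in> quad_field d. algebraic_int x}"

definition totally_positive :: "nat \<Rightarrow> real \<Rightarrow> bool" where
  "totally_positive d x \<longleftrightarrow> x \<in> quad_field d \<and> x > 0 \<and> quad_conj d x > 0"

definition unit_group :: "nat \<Rightarrow> real set" where
  "unit_group d = {u \<in> ring_of_integers d. \<exists>v\<in>ring_of_integers d. u * v = 1}"

definition pos_units :: "nat \<Rightarrow> real set" where
  "pos_units d = {u \<in> unit_group d. totally_positive d u}"

definition fractional_ideal :: "nat \<Rightarrow> real set \<Rightarrow> bool" where
  "fractional_ideal d I \<longleftrightarrow>
     I \<subseteq> quad_field d \<and> 0 \<in> I \<and> I \<noteq> {0} \<and>
     (\<forall>x\<in>I. \<forall>y\<in>I. x + y \<in> I) \<and>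
     (\<forall>r\<in>ring_of_integers d. \<forall>x\<in>I. r * x \<in> I) \<and>
     (\<exists>m\<in>ring_of_integers d. m \<noteq> 0 \<and> (\<forall>x\<in>I. m * x \<in> ring_of_integers d))"

definition integral_ideal :: "nat \<Rightarrow> real set \<Rightarrow> bool" where
  "integral_ideal d I \<longleftrightarrow> fractional_ideal d I \<and> I \<subseteq> ring_of_integers d"

definition ideal_mult :: "real set \<Rightarrow> real set \<Rightarrow> real set" where
  "ideal_mult I J = {(\<Sum>i<n. x i * y i) | (n::nat) x y. \<forall>i<n. x i \<in> I \<and> y i \<in> J}"

definition ideal_inv :: "nat \<Rightarrow> real set \<Rightarrow> real set" where
  "ideal_inv d I = {x \<in> quad_field d. \<forall>y\<in>I. x * y \<in> ring_of_integers d}"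

text \<open>\<open>ideal_scale \<alpha> I\<close> is \<open>(\<alpha>)I\<close>; in particular \<open>ideal_scale \<alpha> (ring_of_integers d)\<close> is the principal ideal \<open>(\<alpha>)\<close>.\<close>

definition ideal_scale :: "real \<Rightarrow> real set \<Rightarrow> real set" where
  "ideal_scale \<alpha> I = (\<lambda>x. \<alpha> * x) ` I"

definition ideal_norm :: "nat \<Rightarrow> real set \<Rightarrow> nat" where
  "ideal_norm d I =
     card (ring_of_integers d //
       {(x, y). x \<in> ring_of_integers d \<and> y \<in> ring_of_integers d \<and> x - y \<in> I})"

definition coprime_ideal :: "nat \<Rightarrow> nat \<Rightarrow> real set \<Rightarrow> bool" where
  "coprime_ideal d q I \<longleftrightarrow>
     {x + real q * y | x y. x \<in> I \<and> y \<in> ring_of_integers d} = ring_of_integers d"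

text \<open>
  The multiplicative congruence \<open>\<alpha> \<equiv> 1 (mod q)\<close> for an element of the field that need not be integral:
  \<open>\<alpha>\<close> is a quotient of integers that are prime to \<open>q\<close> and congruent to each other modulo \<open>q\<close>
  (the numerator is automatically prime to \<open>q\<close>).
\<close>

definition cong_one :: "nat \<Rightarrow> nat \<Rightarrow> real \<Rightarrow> bool" where
  "cong_one d q \<alpha> \<longleftrightarrow>
     (\<exists>x\<in>ring_of_integers d. \<exists>y\<in>ring_of_integers d.
        x \<noteq> 0 \<and> y \<noteq> 0 \<and> coprime_ideal d q (ideal_scale y (ring_of_integers d)) \<and>
        x - y \<in> ideal_scale (real q) (ring_of_integers d) \<and> \<alpha> = x / y)"

definition ray_equiv :: "nat \<Rightarrow> nat \<Rightarrow> real set \<Rightarrow> real set \<Rightarrow> bool" where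
  "ray_equiv d q c a \<longleftrightarrow>
     (\<exists>\<alpha>. totally_positive d \<alpha> \<and> cong_one d q \<alpha> \<and> c = ideal_scale \<alpha> a)"

definition principally_equiv :: "nat \<Rightarrow> real set \<Rightarrow> real set \<Rightarrow> bool" where
  "principally_equiv d c b \<longleftrightarrow> (\<exists>\<alpha>\<in>quad_field d. \<alpha> \<noteq> 0 \<and> c = ideal_scale \<alpha> b)"

definition narrowly_equiv :: "nat \<Rightarrow> real set \<Rightarrow> real set \<Rightarrow> bool" where
  "narrowly_equiv d c b \<longleftrightarrow> (\<exists>\<alpha>. totally_positive d \<alpha> \<and> c = ideal_scale \<alpha> b)"

definition ideals_prime_to :: "nat \<Rightarrow> nat \<Rightarrow> real set set" where
  "ideals_prime_to d q =
     {ideal_mult a (ideal_inv d b) | a b.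
        integral_ideal d a \<and> coprime_ideal d q a \<and>
        integral_ideal d b \<and> coprime_ideal d q b}"

text \<open>
  A homomorphism to the nonzero complex numbers from the group of fractional ideals prime to \<open>q\<close>,
  trivial on the ray of principal ideals \<open>(\<alpha>)\<close> with \<open>\<alpha>\<close> totally positive and \<open>\<alpha> \<equiv> 1 (mod q)\<close>, and
  extended by zero to the integral ideals not prime to \<open>q\<close>.
\<close>

definition ray_class_character :: "nat \<Rightarrow> nat \<Rightarrow> (real set \<Rightarrow> complex) \<Rightarrow> bool" where
  "ray_class_character d q chi \<longleftrightarrow>
     (\<forall>I\<in>ideals_prime_to d q. chi I \<noteq> 0) \<and>
     (\<forall>I\<in>ideals_prime_to d q. \<forall>J\<in>ideals_prime_to d q.
        chi (ideal_mult I J) = chi I * chi J) \<and>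
     (\<forall>\<alpha>. totally_positive d \<alpha> \<and> cong_one d q \<alpha> \<longrightarrow> chi (ideal_scale \<alpha> (ring_of_integers d)) = 1) \<and>
     (\<forall>I. integral_ideal d I \<and> \<not> coprime_ideal d q I \<longrightarrow> chi I = 0)"

text \<open>The series below are used only in their domain of absolute convergence \<open>Re s > 1\<close>.\<close>

definition partial_zeta :: "nat \<Rightarrow> nat \<Rightarrow> complex \<Rightarrow> real set \<Rightarrow> complex" where
  "partial_zeta d q s a =
     infsum (\<lambda>c. of_nat (ideal_norm d c) powr (- s)) {c. integral_ideal d c \<and> ray_equiv d q c a}"

definition partial_hecke_L ::
    "nat \<Rightarrow> complex \<Rightarrow> (real set \<Rightarrow> complex) \<Rightarrow> real set \<Rightarrow> complex" where
  "partial_hecke_L d s chi b =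
     infsum (\<lambda>c. chi c * of_nat (ideal_norm d c) powr (- s))
       {c. integral_ideal d c \<and> principally_equiv d c b}"

text \<open>
  The same series over the narrow class of \<open>b\<close>. The two agree when the field has a unit of norm
  \<open>-1\<close>; otherwise the wide class of \<open>b\<close> is the union of two narrow classes.
\<close>

definition narrow_partial_hecke_L ::
    "nat \<Rightarrow> complex \<Rightarrow> (real set \<Rightarrow> complex) \<Rightarrow> real set \<Rightarrow> complex" where
  "narrow_partial_hecke_L d s chi b =
     infsum (\<lambda>c. chi c * of_nat (ideal_norm d c) powr (- s))
       {c. integral_ideal d c \<and> narrowly_equiv d c b}"

definition lattice :: "real \<Rightarrow> real set" where
  "lattice \<delta> = {of_int m + of_int n * \<delta> | m n. True}"

definition elt :: "real \<Rightarrow> int \<times> int \<Rightarrow> real" where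
  "elt \<delta> p = of_int (fst p) + of_int (snd p) * \<delta>"

definition residue_pairs :: "nat \<Rightarrow> (int \<times> int) set" where
  "residue_pairs q = {(C, D). 0 \<le> C \<and> C \<le> int q - 1 \<and> 0 \<le> D \<and> D \<le> int q - 1 \<and> (C, D) \<noteq> (0, 0)}"

definition residue_pairs_coprime :: "nat \<Rightarrow> nat \<Rightarrow> real set \<Rightarrow> real \<Rightarrow> (int \<times> int) set" where
  "residue_pairs_coprime d q b \<delta> = {p \<in> residue_pairs q. coprime_ideal d q (ideal_scale (elt \<delta> p) b)}"

text \<open>The coset equality \<open>(C + D\<delta>)\<epsilon> + q b\<^sup>-\<^sup>1 = C' + D'\<delta> + q b\<^sup>-\<^sup>1\<close> is written as a membership.\<close>

definition unit_act :: "nat \<Rightarrow> nat \<Rightarrow> real set \<Rightarrow> real \<Rightarrow> real \<Rightarrow> int \<times> int \<Rightarrow> int \<times> int" where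
  "unit_act d q b \<delta> \<epsilon> p =
     (THE p'. p' \<in> residue_pairs q \<and> elt \<delta> p * \<epsilon> - elt \<delta> p' \<in> ideal_scale (real q) (ideal_inv d b))"

definition fundamental_set :: "('g \<Rightarrow> 'a \<Rightarrow> 'a) \<Rightarrow> 'g set \<Rightarrow> 'a set \<Rightarrow> 'a set \<Rightarrow> bool" where
  "fundamental_set act G X T \<longleftrightarrow> T \<subseteq> X \<and> (\<forall>x\<in>X. \<exists>!t. t \<in> T \<and> (\<exists>g\<in>G. act g x = t))"

end

theory Submission
  imports Defs
begin

text \<open>
  An ideal in the narrow class of \<open>b\<close> is \<open>\<alpha>b\<close> with \<open>\<alpha>\<close> totally positive, and it is integral
  exactly when \<open>\<alpha>\<close> lies in \<open>b\<^sup>-\<^sup>1 = [1,\<delta>]\<close>. Reducing \<open>\<alpha>\<close> modulo \<open>q b\<^sup>-\<^sup>1\<close> gives a residue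
  \<open>C + D\<delta>\<close> with \<open>0 \<le> C, D < q\<close>, and \<open>\<alpha>b\<close> is prime to \<open>q\<close> if and only if \<open>(C + D\<delta>)b\<close> is. All other
  ideals are annihilated by the character. The key observation (\<open>ray_part_iff\<close>) is that, for a residue
  \<open>C + D\<delta>\<close> that is prime to \<open>q\<close> in this sense, the ideals \<open>\<alpha>b\<close> with \<open>\<alpha> \<equiv> C + D\<delta>\<close> modulo \<open>q b\<^sup>-\<^sup>1\<close> are
  exactly the integral ideals in the ray class of \<open>(C + D\<delta>)b\<close>; the character is constant on them. Since
  \<open>\<alpha>b\<close> determines \<open>\<alpha>\<close> up to a totally positive unit (\<open>scale_eq_imp_unit\<close>), two residues yield the same
  ray class if they lie in one orbit of the unit group and disjoint sets of ideals otherwise. A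
  fundamental set of residues therefore lists every ray class in question once, and the \<open>L\<close>-series
  splits into the corresponding partial zeta functions.

  The splitting needs absolute convergence for \<open>Re s > 1\<close> (\<open>summable_ideal_norm_powr\<close>), which is obtained
  without a fundamental unit. If \<open>c = \<alpha>b\<close> is integral of norm \<open>n\<close>, the pigeonhole principle gives a
  nonzero \<open>\<beta> = x + y\<surd>d\<close> in \<open>c\<close> with \<open>x\<^sup>2, y\<^sup>2 \<le> n\<close>. As \<open>n\<close> is at most a constant times the absolute norm
  of \<open>\<alpha>\<close>, the element \<open>w = \<beta>/\<alpha>\<close> of \<open>b\<close> has bounded norm, so that only finitely many \<open>w\<close> occur up to
  units. The ideal \<open>c = (\<beta>/w)b\<close> is determined by \<open>(x, y)\<close> and the class of \<open>w\<close>, whence the series is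
  dominated by a constant multiple of the square of \<open>\<Sum>x\<in>\<int>. max(1,|x|) powr - Re s\<close>.

  If some unit \<open>u\<close> has norm \<open>-1\<close>, one of \<open>\<plusminus>\<alpha>\<close>, \<open>\<plusminus>u\<alpha>\<close> is totally positive for every \<open>\<alpha> \<noteq> 0\<close>, so the wide and
  the narrow class of \<open>b\<close> coincide.
\<close>

section \<open>Bounded denominators and a convergent series\<close>

text \<open>
  For \<open>R = \<int>[\<surd>d]\<close> and \<open>x\<close> in the field this is equivalent to integrality of \<open>x\<close>. Unlike the
  definition by a monic polynomial, it is visibly preserved by sums and products.
\<close>

definition almost_integral_over :: "real set \<Rightarrow> real \<Rightarrow> bool" where
  "almost_integral_over R x \<longleftrightarrow> (\<exists>D::nat. D > 0 \<and> (\<forall>k. of_nat D * x ^ k \<in> R))"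

text \<open>In lowest terms \<open>x = m/n\<close>, every power of \<open>n\<close> divides the fixed number \<open>D\<close>.\<close>

lemma Rats_bounded_powers_imp_Ints:
  fixes x :: real
  assumes "x \<in> \<rat>" and D: "D > 0" "\<And>k. of_nat D * x ^ k \<in> \<int>"
  shows "x \<in> \<int>"
proof -
  obtain m n where n: "n > 0" and x: "x = of_int m / of_int n" and cop: "coprime m n"
    using assms(1) by (elim Rats_cases') auto
  have dvd: "n ^ k dvd int D" for k
  proof -
    obtain z where z: "of_nat D * x ^ k = of_int z" using D(2)[of k] by (auto elim: Ints_cases)
    hence "of_nat D * (of_int m :: real) ^ k = of_int z * of_int n ^ k"
      using n by (simp add: x power_divide divide_simps)
    hence "real_of_int (int D * m ^ k) = of_int (z * n ^ k)" by simp
    hence "int D * m ^ k = z * n ^ k" by linarith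
    hence "n ^ k dvd int D * m ^ k" by simp
    moreover have "coprime (n ^ k) (m ^ k)" using cop by (simp add: coprime_commute)
    ultimately show ?thesis using coprime_dvd_mult_left_iff by blast
  qed
  have "n = 1"
  proof (rule ccontr)
    assume "n \<noteq> 1"
    with n have "n \<ge> 2" by simp
    have "int D < 2 ^ D" by (metis less_exp of_nat_less_iff of_nat_numeral of_nat_power)
    also have "\<dots> \<le> n ^ D" using \<open>n \<ge> 2\<close> by (intro power_mono) auto
    finally have "\<not> n ^ D dvd int D" using D(1) by (meson of_nat_0_less_iff zdvd_not_zless)
    thus False using dvd by blast
  qed
  thus ?thesis by (simp add: x)
qed

lemma summable_on_int_powr:
  assumes "\<sigma> > 1"
  shows "(\<lambda>x::int. of_int (max 1 \<bar>x\<bar>) powr - \<sigma> :: real) summable_on UNIV"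
proof -
  define f where "f = (\<lambda>x::int. of_int (max 1 \<bar>x\<bar>) powr - \<sigma> :: real)"
  have "summable (\<lambda>n. real n powr - \<sigma>)" using assms by (simp add: summable_real_powr_iff)
  moreover have "eventually (\<lambda>n. norm (f (int n)) = real n powr - \<sigma>) sequentially"
    using eventually_ge_at_top[of 1] by eventually_elim (simp add: f_def max_def)
  ultimately have "summable (\<lambda>n. norm (f (int n)))" using summable_cong by fastforce
  hence s: "(\<lambda>n. f (int n)) summable_on UNIV" by (rule norm_summable_imp_summable_on)
  hence "f summable_on range int" by (subst summable_on_reindex) (auto simp: o_def)
  moreover from s have "f summable_on range (\<lambda>n. - int n)"
    by (subst summable_on_reindex) (auto simp: o_def f_def inj_def)
  ultimately have "f summable_on (range int \<union> range (\<lambda>n. - int n))" by (rule summable_on_union)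
  moreover have "x \<in> range int \<union> range (\<lambda>n. - int n)" for x
    by (cases x rule: int_cases2) auto
  ultimately show ?thesis unfolding f_def by (metis UNIV_eq_I)
qed

section \<open>Conjugation and norm in a real quadratic field\<close>

locale real_quadratic =
  fixes d :: nat
  assumes sqfree: "squarefree d" and d_gt_1: "d > 1"
begin

abbreviation "rt \<equiv> sqrt (real d)"
abbreviation "K \<equiv> quad_field d"
abbreviation "OK \<equiv> ring_of_integers d"
abbreviation "cj \<equiv> quad_conj d"

text \<open>The order \<open>\<int>[\<surd>d]\<close>, which may have index \<open>2\<close> in the ring of integers.\<close>

definition sqrt_order :: "real set" where
  "sqrt_order = {of_int u + of_int v * rt | u v. True}"

definition nrm :: "real \<Rightarrow> real" where
  "nrm x = x * cj x"

text \<open>A rational \<open>\<surd>d\<close> would be a rational algebraic integer, and \<open>d\<close> a perfect square.\<close>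

lemma sqrt_irrational: "rt \<notin> \<rat>"
proof
  assume rat: "rt \<in> \<rat>"
  have "algebraic_int rt" by auto
  with rat have "rt \<in> \<int>" by (rule rational_algebraic_int_is_int[rotated])
  then obtain k :: int where k: "rt = of_int k" by (auto elim: Ints_cases)
  have "real d = of_int (k ^ 2)"
    by (metis k of_int_power of_nat_0_le_iff real_sqrt_pow2)
  hence "int d = k ^ 2" by linarith
  hence dk: "d = nat \<bar>k\<bar> ^ 2"
    by (metis abs_ge_zero int_nat_eq nat_int nat_power_eq of_nat_power power2_abs)
  with sqfree have "nat \<bar>k\<bar> dvd 1" by (metis dvd_refl squarefree_def)
  with dk d_gt_1 show False by simp
qed

lemma rt_sq: "rt * rt = real d" by simp

lemma field_rep_unique:
  assumes "a \<in> \<rat>" "b \<in> \<rat>" "a' \<in> \<rat>" "b' \<in> \<rat>" "a + b * rt = a' + b' * rt"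
  shows "a = a' \<and> b = b'"
proof -
  have "b = b'"
  proof (rule ccontr)
    assume "b \<noteq> b'"
    hence "rt = (a' - a) / (b - b')" using assms(5) by (simp add: field_simps)
    also have "\<dots> \<in> \<rat>" using assms by (intro Rats_divide Rats_diff)
    finally show False using sqrt_irrational by simp
  qed
  with assms show ?thesis by simp
qed

lemma in_K: "a \<in> \<rat> \<Longrightarrow> b \<in> \<rat> \<Longrightarrow> a + b * rt \<in> K"
  by (auto simp: quad_field_def)

lemma K_cases:
  assumes "x \<in> K"
  obtains a b where "a \<in> \<rat>" "b \<in> \<rat>" "x = a + b * rt"
  using assms by (auto simp: quad_field_def)

lemma cj_rep:
  assumes "a \<in> \<rat>" "b \<in> \<rat>"
  shows "cj (a + b * rt) = a - b * rt"
  unfolding quad_conj_def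
proof (rule the_equality)
  fix y assume "\<exists>a'\<in>\<rat>. \<exists>b'\<in>\<rat>. a + b * rt = a' + b' * rt \<and> y = a' - b' * rt"
  thus "y = a - b * rt" using field_rep_unique assms by blast
qed (use assms in blast)

lemma Rats_in_K: "x \<in> \<rat> \<Longrightarrow> x \<in> K"
  using in_K[of x 0] by simp

lemma cj_Rats: "x \<in> \<rat> \<Longrightarrow> cj x = x"
  using cj_rep[of x 0] by simp

lemma rt_in_K: "rt \<in> K" using in_K[of 0 1] by simp

lemma K_add_cj:
  assumes "x \<in> K" "y \<in> K"
  shows "x + y \<in> K" "cj (x + y) = cj x + cj y"
proof -
  obtain a b where x: "a \<in> \<rat>" "b \<in> \<rat>" "x = a + b * rt" using assms K_cases by metis
  obtain a' b' where y: "a' \<in> \<rat>" "b' \<in> \<rat>" "y = a' + b' * rt" using assms K_cases by metis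
  have xy: "x + y = (a + a') + (b + b') * rt" by (simp add: x y algebra_simps)
  have r: "a + a' \<in> \<rat>" "b + b' \<in> \<rat>" using x y by auto
  show "x + y \<in> K" unfolding xy by (rule in_K[OF r])
  show "cj (x + y) = cj x + cj y"
    unfolding xy cj_rep[OF r]
    unfolding x(3) y(3) cj_rep[OF x(1,2)] cj_rep[OF y(1,2)] by (simp add: algebra_simps)
qed

lemma mult_rep: "(a + b * rt) * (a' + b' * rt) = (a * a' + b * b' * real d) + (a * b' + a' * b) * rt"
proof -
  have "(a + b * s) * (a' + b' * s) = (a * a' + b * b' * (s * s)) + (a * b' + a' * b) * s" for s :: real
    by (simp add: algebra_simps)
  from this[of rt] show ?thesis by (simp only: rt_sq)
qed

lemma K_mult_cj:
  assumes "x \<in> K" "y \<in> K"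
  shows "x * y \<in> K" "cj (x * y) = cj x * cj y"
proof -
  obtain a b where x: "a \<in> \<rat>" "b \<in> \<rat>" "x = a + b * rt" using assms K_cases by metis
  obtain a' b' where y: "a' \<in> \<rat>" "b' \<in> \<rat>" "y = a' + b' * rt" using assms K_cases by metis
  have xy: "x * y = (a * a' + b * b' * real d) + (a * b' + a' * b) * rt"
    unfolding x(3) y(3) by (rule mult_rep)
  have r: "a * a' + b * b' * real d \<in> \<rat>" "a * b' + a' * b \<in> \<rat>" using x y by auto
  show "x * y \<in> K" unfolding xy by (rule in_K[OF r])
  show "cj (x * y) = cj x * cj y"
    unfolding xy cj_rep[OF r]
    unfolding x(3) y(3) cj_rep[OF x(1,2)] cj_rep[OF y(1,2)]
    using mult_rep[of a "- b" a' "- b'"] by (simp add: algebra_simps)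
qed

lemma cj_in_K: "x \<in> K \<Longrightarrow> cj x \<in> K"
  by (elim K_cases) (use in_K[of _ "- _"] in \<open>simp add: cj_rep\<close>)

lemma cj_cj: "x \<in> K \<Longrightarrow> cj (cj x) = x"
  by (elim K_cases) (use cj_rep[of _ "- _"] in \<open>simp add: cj_rep\<close>)

lemma minus_one_K: "- 1 \<in> K" "cj (- 1) = - 1"
  using Rats_in_K cj_Rats by auto

lemma K_minus: "x \<in> K \<Longrightarrow> - x \<in> K" "x \<in> K \<Longrightarrow> cj (- x) = - cj x"
  using K_mult_cj[of "-1" x] minus_one_K by simp_all

lemma nrm_rep: "a \<in> \<rat> \<Longrightarrow> b \<in> \<rat> \<Longrightarrow> nrm (a + b * rt) = a\<^sup>2 - real d * b\<^sup>2"
  unfolding nrm_def using mult_rep[of a b a "- b"] by (simp add: cj_rep algebra_simps power2_eq_square)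

lemma nrm_Rats: "x \<in> K \<Longrightarrow> nrm x \<in> \<rat>"
  by (elim K_cases) (simp add: nrm_rep)

lemma cj_eq_0: "x \<in> K \<Longrightarrow> cj x = 0 \<longleftrightarrow> x = 0"
  by (metis cj_Rats cj_cj Rats_0)

lemma nrm_eq_0: "x \<in> K \<Longrightarrow> nrm x = 0 \<longleftrightarrow> x = 0"
  by (simp add: nrm_def cj_eq_0)

lemma nrm_mult: "x \<in> K \<Longrightarrow> y \<in> K \<Longrightarrow> nrm (x * y) = nrm x * nrm y"
  by (simp add: nrm_def K_mult_cj)

lemma K_inverse: 
  assumes "x \<in> K" shows "inverse x \<in> K"
proof (cases "x = 0")
  case False
  hence "inverse x = inverse (nrm x) * cj x"
    using cj_eq_0[OF assms] by (simp add: nrm_def field_simps)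
  also have "\<dots> \<in> K" using nrm_Rats[OF assms] by (intro K_mult_cj(1) Rats_in_K cj_in_K assms) auto
  finally show ?thesis .
qed (simp add: Rats_in_K)

lemma K_divide: "x \<in> K \<Longrightarrow> y \<in> K \<Longrightarrow> x / y \<in> K"
  by (simp add: divide_inverse K_inverse K_mult_cj)

lemma cj_divide: 
  assumes "x \<in> K" "y \<in> K" "y \<noteq> 0" shows "cj (x / y) = cj x / cj y"
  using K_mult_cj(2)[OF K_divide[OF assms(1,2)] assms(2)] assms cj_eq_0 by (simp add: field_simps)

lemma K_power: "x \<in> K \<Longrightarrow> x ^ k \<in> K \<and> cj (x ^ k) = cj x ^ k"
  by (induction k) (auto simp: K_mult_cj Rats_in_K cj_Rats)

section \<open>The ring of integers\<close>

lemma sqrt_order_cases: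
  assumes "x \<in> sqrt_order" obtains u v where "x = of_int u + of_int v * rt"
  using assms by (auto simp: sqrt_order_def)

lemma sqrt_order_I: "of_int u + of_int v * rt \<in> sqrt_order"
  by (auto simp: sqrt_order_def)

lemma sqrt_order_of_int: "of_int u \<in> sqrt_order"
  using sqrt_order_I[of u 0] by simp

lemma sqrt_order_of_nat: "of_nat u \<in> sqrt_order"
  using sqrt_order_of_int[of "int u"] by simp

lemma sqrt_order_add: "x \<in> sqrt_order \<Longrightarrow> y \<in> sqrt_order \<Longrightarrow> x + y \<in> sqrt_order"
  by (elim sqrt_order_cases)
    (use sqrt_order_I[of "_ + _" "_ + _"] in \<open>simp add: algebra_simps\<close>)

lemma sqrt_order_mult: 
  assumes "x \<in> sqrt_order" "y \<in> sqrt_order" shows "x * y \<in> sqrt_order"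
proof -
  obtain a b where x: "x = of_int a + of_int b * rt" using assms sqrt_order_cases by metis
  obtain a' b' where y: "y = of_int a' + of_int b' * rt" using assms sqrt_order_cases by metis
  have "x * y = of_int (a * a' + b * b' * int d) + of_int (a * b' + a' * b) * rt"
    unfolding x y mult_rep by simp
  thus ?thesis using sqrt_order_I by metis
qed

lemma sqrt_order_sum: "(\<And>i. i \<in> A \<Longrightarrow> f i \<in> sqrt_order) \<Longrightarrow> sum f A \<in> sqrt_order"
  by (induction A rule: infinite_finite_induct) 
    (auto intro!: sqrt_order_add sqrt_order_of_int[of 0, simplified])

lemma cj_sqrt_order: "x \<in> sqrt_order \<Longrightarrow> cj x \<in> sqrt_order"
  by (elim sqrt_order_cases) (use sqrt_order_I[of _ "- _"] in \<open>simp add: cj_rep\<close>)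

lemma sqrt_order_Rats:
  assumes "x \<in> sqrt_order" "x \<in> \<rat>" shows "x \<in> \<int>"
proof -
  obtain u v where x: "x = of_int u + of_int v * rt" using assms sqrt_order_cases by metis
  have "of_int v = (0::real)"
    using field_rep_unique[of x 0 "of_int u" "of_int v"] assms x by simp
  thus ?thesis by (simp add: x)
qed

lemma K_denominator:
  assumes "x \<in> K" shows "\<exists>D::nat. D > 0 \<and> of_nat D * x \<in> sqrt_order"
proof -
  obtain a b where x: "a \<in> \<rat>" "b \<in> \<rat>" "x = a + b * rt" using assms K_cases by metis
  obtain m n where a: "n > 0" "a = of_int m / of_int n" using x(1) by (elim Rats_cases') auto
  obtain m' n' where b: "n' > 0" "b = of_int m' / of_int n'" using x(2) by (elim Rats_cases') auto
  have "real (nat (n * n')) * x = of_int (m * n') + of_int (m' * n) * rt"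
    using a b by (simp add: x field_simps)
  hence "real (nat (n * n')) * x \<in> sqrt_order" using sqrt_order_I by metis
  moreover have "nat (n * n') > 0" using a(1) b(1) by simp
  ultimately show ?thesis by blast
qed

abbreviation "almost_integral \<equiv> almost_integral_over sqrt_order"

lemma almost_integral_cj:
  assumes "x \<in> K" "almost_integral x" shows "almost_integral (cj x)"
proof -
  obtain D :: nat where D: "D > 0" "\<And>k. of_nat D * x ^ k \<in> sqrt_order"
    using assms by (auto simp: almost_integral_over_def)
  have "of_nat D * cj x ^ k = cj (of_nat D * x ^ k)" for k
    using K_power[OF assms(1), of k] by (simp add: K_mult_cj Rats_in_K cj_Rats)
  hence "of_nat D * cj x ^ k \<in> sqrt_order" for k using D(2) cj_sqrt_order by metis
  thus ?thesis using D(1) by (auto simp: almost_integral_over_def)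
qed

lemma almost_integral_mult:
  assumes "almost_integral x" "almost_integral y" shows "almost_integral (x * y)"
proof -
  obtain D :: nat where D: "D > 0" "\<And>k. of_nat D * x ^ k \<in> sqrt_order"
    using assms by (auto simp: almost_integral_over_def)
  obtain E :: nat where E: "E > 0" "\<And>k. of_nat E * y ^ k \<in> sqrt_order"
    using assms by (auto simp: almost_integral_over_def)
  have "of_nat (D * E) * (x * y) ^ k = (of_nat D * x ^ k) * (of_nat E * y ^ k)" for k
    by (simp add: power_mult_distrib)
  thus ?thesis unfolding almost_integral_over_def
    using D E sqrt_order_mult by (metis nat_0_less_mult_iff)
qed

lemma almost_integral_add:
  assumes "almost_integral x" "almost_integral y" shows "almost_integral (x + y)"
proof -
  obtain D :: nat where D: "D > 0" "\<And>k. of_nat D * x ^ k \<in> sqrt_order"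
    using assms by (auto simp: almost_integral_over_def)
  obtain E :: nat where E: "E > 0" "\<And>k. of_nat E * y ^ k \<in> sqrt_order"
    using assms by (auto simp: almost_integral_over_def)
  have "of_nat (D * E) * (x + y) ^ k \<in> sqrt_order" for k
  proof -
    have "of_nat (D * E) * (x + y) ^ k
        = (\<Sum>i\<le>k. of_nat (k choose i) * ((of_nat D * x ^ i) * (of_nat E * y ^ (k - i))))"
      by (simp add: binomial_ring sum_distrib_left algebra_simps)
    also have "\<dots> \<in> sqrt_order"
      by (intro sqrt_order_sum sqrt_order_mult sqrt_order_of_nat D E)
    finally show ?thesis .
  qed
  thus ?thesis unfolding almost_integral_over_def
    using D(1) E(1) by (metis nat_0_less_mult_iff)
qed

lemma almost_integral_Rats:
  assumes "almost_integral x" "x \<in> \<rat>" shows "x \<in> \<int>"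
  using assms Rats_bounded_powers_imp_Ints[of x] sqrt_order_Rats
  unfolding almost_integral_over_def by (metis Rats_mult Rats_of_nat Rats_power)

text \<open>
  By the monic equation of degree \<open>n\<close>, all powers of \<open>x\<close> are integer combinations of the first \<open>n\<close>,
  so a common denominator of those serves for all powers.
\<close>

lemma algebraic_int_imp_almost_integral:
  assumes "x \<in> K" "algebraic_int x" shows "almost_integral x"
proof -
  obtain p where p: "lead_coeff p = 1" "\<forall>i. coeff p i \<in> \<int>" "poly p x = 0"
    using assms(2) by (auto elim: algebraic_int.cases)
  define n where "n = degree p"
  have xn: "x ^ n = (\<Sum>i<n. - coeff p i * x ^ i)"
  proof -
    have "poly p x = (\<Sum>i<n. coeff p i * x ^ i) + x ^ n"
      using p(1) by (simp add: poly_altdef n_def lessThan_Suc_atMost[symmetric])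
    thus ?thesis using p(3) by (simp add: sum_negf)
  qed
  have "\<exists>D::nat. D > 0 \<and> (\<forall>k<m. of_nat D * x ^ k \<in> sqrt_order)" for m
  proof (induction m)
    case (Suc m)
    then obtain D :: nat where D: "D > 0" "\<forall>k<m. of_nat D * x ^ k \<in> sqrt_order" by blast
    obtain E :: nat where E: "E > 0" "of_nat E * x ^ m \<in> sqrt_order"
      using K_denominator K_power assms(1) by metis
    have "of_nat (D * E) * x ^ k \<in> sqrt_order" if "k < Suc m" for k
    proof (cases "k = m")
      case True
      have "of_nat (D * E) * x ^ m = of_nat D * (of_nat E * x ^ m)" by simp
      thus ?thesis using True E(2) sqrt_order_mult sqrt_order_of_nat by metis
    next
      case False
      have "of_nat (D * E) * x ^ k = of_nat E * (of_nat D * x ^ k)" by simp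
      thus ?thesis using False that D(2) sqrt_order_mult sqrt_order_of_nat by (metis less_SucE)
    qed
    thus ?case using D(1) E(1) by (metis nat_0_less_mult_iff)
  qed auto
  then obtain D :: nat where D: "D > 0" "\<forall>k<n. of_nat D * x ^ k \<in> sqrt_order" by blast
  have "of_nat D * x ^ k \<in> sqrt_order" for k
  proof (induction k rule: less_induct)
    case (less k)
    show ?case
    proof (cases "k < n")
      case False
      have "of_nat D * x ^ k = of_nat D * (x ^ n * x ^ (k - n))"
        using False by (simp add: power_add[symmetric])
      also have "\<dots> = (\<Sum>i<n. (- coeff p i) * (of_nat D * x ^ (i + (k - n))))"
        unfolding xn by (simp add: sum_distrib_left sum_distrib_right power_add algebra_simps)
      also have "\<dots> \<in> sqrt_order"
      proof (rule sqrt_order_sum)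
        fix i assume i: "i \<in> {..<n}"
        have "- coeff p i \<in> \<int>" using p(2) by simp
        hence "- coeff p i \<in> sqrt_order" by (metis Ints_cases sqrt_order_of_int)
        moreover have "of_nat D * x ^ (i + (k - n)) \<in> sqrt_order"
          using i False by (intro less) auto
        ultimately show "- coeff p i * (of_nat D * x ^ (i + (k - n))) \<in> sqrt_order"
          by (rule sqrt_order_mult)
      qed
      finally show ?thesis .
    qed (use D in auto)
  qed
  with D(1) show ?thesis by (auto simp: almost_integral_over_def)
qed

lemma almost_integral_imp_trace_norm_Ints:
  assumes "x \<in> K" "almost_integral x" shows "x + cj x \<in> \<int>" "nrm x \<in> \<int>"
proof -
  have "x + cj x \<in> \<rat>" using assms(1) by (elim K_cases) (auto simp: cj_rep)
  thus "x + cj x \<in> \<int>"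
    using assms almost_integral_Rats almost_integral_add almost_integral_cj by blast
  show "nrm x \<in> \<int>"
    using almost_integral_Rats almost_integral_mult almost_integral_cj nrm_Rats assms
    unfolding nrm_def by blast
qed

text \<open>Conversely, \<open>x\<close> is a root of \<open>X\<^sup>2 - (x + x')X + xx'\<close>, whose coefficients are rational and
  almost integral, hence integers.\<close>

lemma OK_iff: "x \<in> OK \<longleftrightarrow> x \<in> K \<and> almost_integral x"
proof
  assume x: "x \<in> K \<and> almost_integral x"
  define p where "p = [:nrm x, - (x + cj x), 1:]"
  have "x + cj x \<in> \<int>" "nrm x \<in> \<int>"
    using almost_integral_imp_trace_norm_Ints[of x] x by auto
  hence "coeff p i \<in> \<int>" for i
    using Ints_minus[of "x + cj x"]
    by (auto simp: p_def coeff_pCons split: nat.splits)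
  moreover have "poly p x = 0" "lead_coeff p = 1" by (auto simp: p_def nrm_def algebra_simps)
  ultimately show "x \<in> OK" using x by (auto simp: ring_of_integers_def intro: algebraic_int.intros)
qed (auto simp: ring_of_integers_def algebraic_int_imp_almost_integral)

lemma OK_K: "x \<in> OK \<Longrightarrow> x \<in> K" by (simp add: OK_iff)
lemma OK_add: "x \<in> OK \<Longrightarrow> y \<in> OK \<Longrightarrow> x + y \<in> OK"
  by (simp add: OK_iff almost_integral_add K_add_cj)
lemma OK_mult: "x \<in> OK \<Longrightarrow> y \<in> OK \<Longrightarrow> x * y \<in> OK"
  by (simp add: OK_iff almost_integral_mult K_mult_cj)
lemma OK_of_int: "of_int k \<in> OK"
  by (simp add: ring_of_integers_def Rats_in_K)
lemma OK_of_nat: "of_nat k \<in> OK"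
  by (simp add: ring_of_integers_def Rats_in_K)
lemma OK_1: "1 \<in> OK" using OK_of_int[of 1] by simp
lemma OK_0: "0 \<in> OK" using OK_of_int[of 0] by simp
lemma OK_minus: "x \<in> OK \<Longrightarrow> - x \<in> OK"
  using OK_mult[OF OK_of_int[of "-1"]] by fastforce
lemma OK_diff: "x \<in> OK \<Longrightarrow> y \<in> OK \<Longrightarrow> x - y \<in> OK"
  using OK_add[of x "- y"] OK_minus by simp
lemma OK_cj: "x \<in> OK \<Longrightarrow> cj x \<in> OK"
  by (simp add: OK_iff almost_integral_cj cj_in_K)
lemma OK_nrm: "x \<in> OK \<Longrightarrow> nrm x \<in> \<int>"
  by (simp add: OK_iff almost_integral_imp_trace_norm_Ints)
lemma OK_rt: "rt \<in> OK" unfolding ring_of_integers_def using rt_in_K by auto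
lemma OK_sqrt_order: "x \<in> sqrt_order \<Longrightarrow> x \<in> OK"
  by (auto simp: sqrt_order_def intro!: OK_add OK_mult OK_of_int OK_rt)
lemma OK_Rats: "x \<in> OK \<Longrightarrow> x \<in> \<rat> \<Longrightarrow> x \<in> \<int>"
  by (simp add: OK_iff almost_integral_Rats)

text \<open>
  The coefficient of \<open>\<surd>d\<close> in \<open>2d x\<close> is \<open>(x - x')\<surd>d\<close>, a rational algebraic integer. The size of the factor
  is immaterial below; what matters is that one factor serves for all \<open>x\<close>.
\<close>

lemma OK_denominator:
  assumes "x \<in> OK" shows "2 * real d * x \<in> sqrt_order"
proof -
  obtain a b where x: "a \<in> \<rat>" "b \<in> \<rat>" "x = a + b * rt" using assms OK_K K_cases by metis
  have "2 * b * real d = (x - cj x) * rt"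
    by (simp add: x cj_rep)
  also have "\<dots> \<in> OK" using assms by (intro OK_mult OK_diff OK_cj OK_rt)
  finally have "2 * b * real d \<in> \<int>" using x by (intro OK_Rats) auto
  then obtain v where v: "2 * b * real d = of_int v" by (auto elim: Ints_cases)
  have "x + cj x \<in> \<int>"
    using assms by (simp add: OK_iff almost_integral_imp_trace_norm_Ints)
  then obtain u where "x + cj x = of_int u" by (auto elim: Ints_cases)
  hence u: "2 * a = of_int u" by (simp add: x cj_rep)
  have "2 * real d * x = of_int (int d * u) + of_int v * rt"
    unfolding x(3) of_int_mult u[symmetric] v[symmetric] by (simp add: algebra_simps)
  thus ?thesis using sqrt_order_I by metis
qed

section \<open>Ideals, units and coprimality\<close>

definition ok_module :: "real set \<Rightarrow> bool" where
  "ok_module I \<longleftrightarrow> 0 \<in> I \<and> (\<forall>x\<in>I. \<forall>y\<in>I. x + y \<in> I) \<and> (\<forall>r\<in>OK. \<forall>x\<in>I. r * x \<in> I)"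

lemma ok_moduleD:
  assumes "ok_module I"
  shows "0 \<in> I" "x \<in> I \<Longrightarrow> y \<in> I \<Longrightarrow> x + y \<in> I" "r \<in> OK \<Longrightarrow> x \<in> I \<Longrightarrow> r * x \<in> I"
    "r \<in> OK \<Longrightarrow> x \<in> I \<Longrightarrow> x * r \<in> I" "x \<in> I \<Longrightarrow> y \<in> I \<Longrightarrow> x - y \<in> I"
proof -
  show mult: "r * x \<in> I" if "r \<in> OK" "x \<in> I" for r x using assms that by (auto simp: ok_module_def)
  show add: "x + y \<in> I" if "x \<in> I" "y \<in> I" for x y using assms that by (auto simp: ok_module_def)
  show "0 \<in> I" using assms by (auto simp: ok_module_def)
  show "r \<in> OK \<Longrightarrow> x \<in> I \<Longrightarrow> x * r \<in> I" using mult[of r x] by (simp add: mult.commute)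
  show "x \<in> I \<Longrightarrow> y \<in> I \<Longrightarrow> x - y \<in> I"
    using add[of x "- y"] mult[of "-1" y] OK_minus[OF OK_1] by simp
qed

lemma ok_module_sum: "ok_module I \<Longrightarrow> (\<And>i. i \<in> A \<Longrightarrow> f i \<in> I) \<Longrightarrow> sum f A \<in> I"
  by (induction A rule: infinite_finite_induct) (auto intro: ok_moduleD)

lemma ok_module_OK: "ok_module OK"
  by (auto simp: ok_module_def OK_0 OK_add OK_mult)

lemma ok_module_ideal: "integral_ideal d I \<Longrightarrow> ok_module I"
  by (auto simp: ok_module_def integral_ideal_def fractional_ideal_def)

lemma ok_module_ideal_inv: "ok_module (ideal_inv d I)"
  unfolding ok_module_def ideal_inv_def
  by (auto simp: Rats_in_K OK_0 K_add_cj K_mult_cj OK_K distrib_right OK_add mult.assoc OK_mult)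

lemma in_ideal_scale: "x \<in> ideal_scale a I \<longleftrightarrow> (\<exists>y\<in>I. x = a * y)"
  by (auto simp: ideal_scale_def)

lemma ok_module_scale:
  assumes "ok_module I" shows "ok_module (ideal_scale a I)"
  unfolding ok_module_def
proof (intro conjI ballI)
  show "0 \<in> ideal_scale a I" using ok_moduleD(1)[OF assms] by (auto simp: in_ideal_scale intro!: bexI[of _ 0])
next
  fix x y assume "x \<in> ideal_scale a I" "y \<in> ideal_scale a I"
  thus "x + y \<in> ideal_scale a I"
    using ok_moduleD(2)[OF assms] by (auto simp: in_ideal_scale simp flip: distrib_left)
next
  fix r x assume "r \<in> OK" "x \<in> ideal_scale a I"
  thus "r * x \<in> ideal_scale a I"
    using ok_moduleD(3)[OF assms] by (auto simp: in_ideal_scale mult.left_commute)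
qed

lemma generator_in_principal: "x \<in> ideal_scale x OK"
  unfolding in_ideal_scale using OK_1 by (intro bexI[of _ 1]) simp_all

lemma ideal_scale_scale: "ideal_scale a (ideal_scale b I) = ideal_scale (a * b) I"
  by (auto simp: ideal_scale_def image_image mult.assoc)

lemma ideal_scale_1: "ideal_scale 1 I = I"
  by (auto simp: ideal_scale_def)

lemma integral_ideal_subset: "integral_ideal d I \<Longrightarrow> x \<in> I \<Longrightarrow> x \<in> OK"
  by (auto simp: integral_ideal_def)

lemma integral_ideal_nonzero:
  assumes "integral_ideal d I" obtains t where "t \<in> I" "t \<noteq> 0"
  using assms by (auto simp: integral_ideal_def fractional_ideal_def)

lemma integral_idealI:
  assumes "ok_module I" "I \<subseteq> OK" "t \<in> I" "t \<noteq> 0"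
  shows "integral_ideal d I"
  using assms OK_1 OK_K unfolding integral_ideal_def fractional_ideal_def ok_module_def
  by (auto intro!: bexI[of _ 1])

lemma integral_ideal_OK: "integral_ideal d OK"
  using integral_idealI[OF ok_module_OK _ OK_1] by auto

lemma integral_ideal_principal:
  assumes "x \<in> OK" "x \<noteq> 0" shows "integral_ideal d (ideal_scale x OK)"
  using assms OK_mult
  by (intro integral_idealI[OF ok_module_scale[OF ok_module_OK] _ generator_in_principal])
    (auto simp: in_ideal_scale)

lemma integral_ideal_scale_iff:
  assumes "integral_ideal d b" "a \<in> K" "a \<noteq> 0"
  shows "integral_ideal d (ideal_scale a b) \<longleftrightarrow> a \<in> ideal_inv d b"
proof
  assume "integral_ideal d (ideal_scale a b)"
  hence "a * x \<in> OK" if "x \<in> b" for x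
    using that by (auto simp: integral_ideal_def ideal_scale_def)
  thus "a \<in> ideal_inv d b" using assms by (auto simp: ideal_inv_def)
next
  assume a: "a \<in> ideal_inv d b"
  obtain t where t: "t \<in> b" "t \<noteq> 0" using integral_ideal_nonzero assms(1) by blast
  show "integral_ideal d (ideal_scale a b)"
  proof (rule integral_idealI)
    show "ok_module (ideal_scale a b)" by (intro ok_module_scale ok_module_ideal assms)
    show "ideal_scale a b \<subseteq> OK" using a by (auto simp: in_ideal_scale ideal_inv_def)
    show "a * t \<in> ideal_scale a b" using t by (auto simp: in_ideal_scale)
    show "a * t \<noteq> 0" using t assms by simp
  qed
qed

lemma unit_scale:
  assumes "u \<in> unit_group d" "ok_module I" shows "ideal_scale u I = I"
proof -
  obtain v where v: "u \<in> OK" "v \<in> OK" "u * v = 1" using assms by (auto simp: unit_group_def)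
  have "x \<in> ideal_scale u I" if "x \<in> I" for x
    using v that ok_moduleD(3)[OF assms(2)] unfolding in_ideal_scale
    by (intro bexI[of _ "v * x"]) (auto simp flip: mult.assoc)
  moreover have "x \<in> I" if "x \<in> ideal_scale u I" for x
    using v that ok_moduleD(3)[OF assms(2)] by (auto simp: in_ideal_scale)
  ultimately show ?thesis by blast
qed

text \<open>
  For a fixed nonzero \<open>t\<close> in the ideal, all \<open>a\<^sup>k t\<close> are integral; multiplying by the conjugate of \<open>t\<close> shows
  that the norm of \<open>t\<close>, up to the factor \<open>2d\<close>, is a common denominator of all powers of \<open>a\<close>.
\<close>

lemma stabilizer_in_OK:
  assumes b: "integral_ideal d b" and a: "a \<in> K" "\<And>x. x \<in> b \<Longrightarrow> a * x \<in> b"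
  shows "a \<in> OK"
proof -
  obtain t where t: "t \<in> b" "t \<noteq> 0" using integral_ideal_nonzero assms(1) by blast
  have tO: "t \<in> OK" using t b integral_ideal_subset by blast
  obtain z where z: "nrm t = of_int z" using OK_nrm[OF tO] by (auto elim: Ints_cases)
  have z0: "z \<noteq> 0" using nrm_eq_0[of t] OK_K[OF tO] t(2) z by auto
  have "a ^ k * t \<in> b" for k
    by (induction k) (use a(2) t in \<open>auto simp: mult.assoc\<close>)
  hence mem: "a ^ k * t \<in> OK" for k using integral_ideal_subset[OF b] by blast
  \<comment> \<open>The sign makes the common denominator a positive integer.\<close>
  have "of_nat (2 * d * nat \<bar>z\<bar>) * a ^ k \<in> sqrt_order" for k
  proof -
    have "(of_int (sgn z) * cj t) * (a ^ k * t) \<in> OK"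
      by (intro OK_mult mem OK_cj tO OK_of_int)
    also have "(of_int (sgn z) * cj t) * (a ^ k * t) = of_int (sgn z) * nrm t * a ^ k"
      by (simp add: nrm_def)
    also have "of_int (sgn z) * nrm t = of_int \<bar>z\<bar>"
      unfolding z by (simp only: of_int_mult[symmetric] sgn_mult_abs[symmetric])
        (simp add: sgn_if abs_if)
    finally have "2 * real d * (of_int \<bar>z\<bar> * a ^ k) \<in> sqrt_order" by (rule OK_denominator)
    thus ?thesis by (simp add: mult.assoc)
  qed
  moreover have "2 * d * nat \<bar>z\<bar> > 0" using z0 d_gt_1 by simp
  ultimately show ?thesis unfolding OK_iff almost_integral_over_def using a(1) by blast
qed

lemma scale_eq_imp_unit:
  assumes b: "integral_ideal d b" and K: "x \<in> K" "y \<in> K" and nz: "x \<noteq> 0" "y \<noteq> 0"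
    and eq: "ideal_scale x b = ideal_scale y b"
  shows "y / x \<in> unit_group d"
proof -
  have *: "u / v \<in> OK" if "u \<in> K" "v \<in> K" "v \<noteq> 0" "ideal_scale u b = ideal_scale v b" for u v
  proof (rule stabilizer_in_OK[OF b])
    fix z assume "z \<in> b"
    hence "u * z \<in> ideal_scale v b" unfolding that(4)[symmetric] by (auto simp: in_ideal_scale)
    then obtain z' where "z' \<in> b" "u * z = v * z'" by (auto simp: in_ideal_scale)
    thus "u / v * z \<in> b" using that by (simp add: field_simps)
  qed (use that K_divide in auto)
  have "y / x \<in> OK" "x / y \<in> OK" "y / x * (x / y) = 1"
    using *[of y x] *[of x y] assms by auto
  thus ?thesis unfolding unit_group_def by blast
qed

lemma coprime_ideal_iff:
  assumes "integral_ideal d I"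
  shows "coprime_ideal d q I \<longleftrightarrow> (\<exists>x\<in>I. \<exists>y\<in>OK. x + real q * y = 1)"
proof
  assume "coprime_ideal d q I"
  hence "1 \<in> {x + real q * y | x y. x \<in> I \<and> y \<in> OK}" unfolding coprime_ideal_def using OK_1 by simp
  then obtain x y where "1 = x + real q * y" "x \<in> I" "y \<in> OK" by blast
  thus "\<exists>x\<in>I. \<exists>y\<in>OK. x + real q * y = 1" by (intro bexI[of _ x] bexI[of _ y]) simp_all
next
  assume "\<exists>x\<in>I. \<exists>y\<in>OK. x + real q * y = 1"
  then obtain x y where xy: "x \<in> I" "y \<in> OK" "x + real q * y = 1" by blast
  have "z \<in> {x + real q * y | x y. x \<in> I \<and> y \<in> OK}" if "z \<in> OK" for z
  proof -
    have "z = z * (x + real q * y)" using xy(3) by simp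
    also have "\<dots> = z * x + real q * (z * y)" by (simp add: algebra_simps)
    finally show ?thesis
      using ok_moduleD(3)[OF ok_module_ideal[OF assms] that xy(1)] OK_mult[OF that xy(2)] by blast
  qed
  moreover have "x + real q * y \<in> OK" if "x \<in> I" "y \<in> OK" for x y
    using that integral_ideal_subset[OF assms] by (intro OK_add OK_mult OK_of_nat) auto
  ultimately show "coprime_ideal d q I" unfolding coprime_ideal_def by blast
qed

text \<open>Equivalently, no ideal contained in \<open>(q)\<close> is prime to \<open>q\<close>.\<close>

lemma inverse_nat_notin_OK: "q > 1 \<Longrightarrow> y \<in> OK \<Longrightarrow> real q * y \<noteq> 1"
proof
  assume q: "q > 1" "y \<in> OK" "real q * y = 1"
  hence y: "y = 1 / real q" by (simp add: field_simps)
  hence "y \<in> \<int>" using OK_Rats[OF q(2)] by simp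
  then obtain k where "y = of_int k" by (auto elim: Ints_cases)
  hence "int q * k = 1" using q(3) by (metis of_int_1 of_int_eq_iff of_int_mult of_int_of_nat_eq)
  thus False using q(1) by (simp add: zmult_eq_1_iff)
qed

section \<open>Ray classes and congruences modulo \<open>q b\<^sup>-\<^sup>1\<close>\<close>

lemma totally_positiveD:
  assumes "totally_positive d x" shows "x \<in> K" "x > 0" "cj x > 0" "x \<noteq> 0"
  using assms by (auto simp: totally_positive_def)

lemma totally_positive_mult:
  "totally_positive d x \<Longrightarrow> totally_positive d y \<Longrightarrow> totally_positive d (x * y)"
  by (simp add: totally_positive_def K_mult_cj)

lemma totally_positive_divide:
  "totally_positive d x \<Longrightarrow> totally_positive d y \<Longrightarrow> totally_positive d (x / y)"
  by (simp add: totally_positive_def K_divide cj_divide)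

lemma inv_times_in_OK: "x \<in> ideal_inv d b \<Longrightarrow> y \<in> b \<Longrightarrow> x * y \<in> OK"
  by (auto simp: ideal_inv_def)

text \<open>
  Additive congruence modulo \<open>q b\<^sup>-\<^sup>1\<close>. For multipliers in \<open>b\<^sup>-\<^sup>1\<close> it is the counterpart of the
  multiplicative congruence that defines ray classes.
\<close>

abbreviation cong_inv :: "nat \<Rightarrow> real set \<Rightarrow> real \<Rightarrow> real \<Rightarrow> bool" where
  "cong_inv q b x y \<equiv> x - y \<in> ideal_scale (real q) (ideal_inv d b)"

lemma cong_inv_times:
  assumes "cong_inv q b x y" "t \<in> b"
  shows "\<exists>z\<in>OK. x * t - y * t = real q * z"
proof -
  obtain w where w: "w \<in> ideal_inv d b" "x - y = real q * w" using assms(1) by (auto simp: in_ideal_scale)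
  have "x * t - y * t = (x - y) * t" by (simp add: algebra_simps)
  also have "\<dots> = real q * (w * t)" using w by simp
  finally show ?thesis using inv_times_in_OK[OF w(1) assms(2)] by blast
qed

lemma ok_module_cong_inv: "ok_module (ideal_scale (real q) (ideal_inv d b))"
  by (intro ok_module_scale ok_module_ideal_inv)

lemma cong_inv_sym: "cong_inv q b x y \<Longrightarrow> cong_inv q b y x"
  using ok_moduleD(3)[OF ok_module_cong_inv OK_minus[OF OK_1], of "x - y" q b] by simp

lemma cong_inv_trans: "cong_inv q b x y \<Longrightarrow> cong_inv q b y z \<Longrightarrow> cong_inv q b x z"
  using ok_moduleD(2)[OF ok_module_cong_inv, of "x - y" q b "y - z"] by simp

lemma cong_inv_mult: "r \<in> OK \<Longrightarrow> cong_inv q b x y \<Longrightarrow> cong_inv q b (x * r) (y * r)"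
  using ok_moduleD(4)[OF ok_module_cong_inv, of r "x - y" q b] by (simp add: algebra_simps)

lemma coprime_cong_inv:
  assumes b: "integral_ideal d b"
    and x: "integral_ideal d (ideal_scale x b)" and y: "integral_ideal d (ideal_scale y b)"
    and cong: "cong_inv q b x y" and cop: "coprime_ideal d q (ideal_scale y b)"
  shows "coprime_ideal d q (ideal_scale x b)"
proof -
  obtain t z where t: "t \<in> b" "z \<in> OK" "y * t + real q * z = 1"
    using cop coprime_ideal_iff[OF y] by (auto simp: in_ideal_scale)
  obtain w where w: "w \<in> OK" "x * t - y * t = real q * w" using cong_inv_times[OF cong t(1)] by blast
  have "x * t + real q * (z - w) = 1" using t(3) w(2) by (simp add: algebra_simps)
  moreover have "x * t \<in> ideal_scale x b" "z - w \<in> OK"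
    using t w OK_diff by (auto simp: in_ideal_scale)
  ultimately show ?thesis using coprime_ideal_iff[OF x] by blast
qed

text \<open>
  Let the ratio \<open>a/g = x/y\<close> with \<open>x \<equiv> y\<close> modulo \<open>q\<close>. Then \<open>y(a - g) = (x - y)g\<close> lies in \<open>q b\<^sup>-\<^sup>1\<close>,
  and since \<open>y\<close> is invertible modulo \<open>q\<close>, so does \<open>a - g\<close>.
\<close>

lemma ray_equiv_imp_cong:
  assumes b: "integral_ideal d b" and g: "totally_positive d g" "g \<in> ideal_inv d b"
    and c: "integral_ideal d c" "ray_equiv d q c (ideal_scale g b)"
  shows "\<exists>a. totally_positive d a \<and> a \<in> ideal_inv d b \<and> cong_inv q b a g \<and> c = ideal_scale a b"
proof -
  obtain e where e: "totally_positive d e" "cong_one d q e" "c = ideal_scale (e * g) b"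
    using c(2) by (auto simp: ray_equiv_def ideal_scale_scale)
  obtain x y z where xy: "x \<in> OK" "y \<in> OK" "x \<noteq> 0" "y \<noteq> 0" "e = x / y"
      "coprime_ideal d q (ideal_scale y OK)" "z \<in> OK" "x - y = real q * z"
    using e(2) by (auto simp: cong_one_def in_ideal_scale)
  have tp: "totally_positive d (e * g)" using e g totally_positive_mult by blast
  have inv: "e * g \<in> ideal_inv d b"
    using integral_ideal_scale_iff[OF b, of "e * g"] totally_positiveD[OF tp] c(1) e(3) by simp
  have "integral_ideal d (ideal_scale y OK)" using xy(2,4) by (rule integral_ideal_principal)
  then obtain u v where uv: "u \<in> OK" "v \<in> OK" "y * u + real q * v = 1"
    using xy(6) coprime_ideal_iff by (auto simp: in_ideal_scale)
  have "e * g - g = (y * u + real q * v) * (e * g - g)" using uv by simp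
  also have "\<dots> = real q * (u * (z * g) + v * (e * g - g))"
  proof -
    have "y * (e * g - g) = (x - y) * g" using xy(4,5) by (simp add: field_simps)
    also have "\<dots> = real q * (z * g)" using xy by simp
    finally have *: "y * (e * g - g) = real q * (z * g)" .
    have "(y * u + real q * v) * (e * g - g) = u * (y * (e * g - g)) + real q * (v * (e * g - g))"
      by (simp only: distrib_left distrib_right mult_ac)
    thus ?thesis unfolding * by (simp only: distrib_left mult_ac)
  qed
  finally have "e * g - g = real q * (u * (z * g) + v * (e * g - g))" .
  moreover have "u * (z * g) + v * (e * g - g) \<in> ideal_inv d b"
    using uv xy g inv ok_moduleD(2,3,5)[OF ok_module_ideal_inv] by simp
  ultimately have "cong_inv q b (e * g) g" unfolding in_ideal_scale by blast
  thus ?thesis using tp inv e(3) by blast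
qed

text \<open>
  As \<open>g b\<close> is prime to \<open>q\<close>, some \<open>t \<in> b\<close> satisfies \<open>g t \<equiv> 1\<close> modulo \<open>q\<close>. Then \<open>a t\<close> and \<open>g t\<close> are
  integers, congruent modulo \<open>q\<close> and prime to \<open>q\<close>, with quotient \<open>a/g\<close>.
\<close>

lemma cong_imp_ray_equiv:
  assumes q: "q > 1" and b: "integral_ideal d b"
    and g: "totally_positive d g" "g \<in> ideal_inv d b" "coprime_ideal d q (ideal_scale g b)"
    and a: "totally_positive d a" "a \<in> ideal_inv d b" and cong: "cong_inv q b a g"
  shows "ray_equiv d q (ideal_scale a b) (ideal_scale g b)"
proof -
  have gb: "integral_ideal d (ideal_scale g b)"
    using integral_ideal_scale_iff[OF b] totally_positiveD[OF g(1)] g(2) by blast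
  obtain t z where t: "t \<in> b" "z \<in> OK" "g * t + real q * z = 1"
    using g(3) coprime_ideal_iff[OF gb] by (auto simp: in_ideal_scale)
  obtain w where w: "w \<in> OK" "a * t - g * t = real q * w" using cong_inv_times[OF cong t(1)] by blast
  have t0: "t \<noteq> 0" using t(3) inverse_nat_notin_OK[OF q t(2)] by auto
  have nz: "a \<noteq> 0" "g \<noteq> 0" using totally_positiveD a(1) g(1) by auto
  have O: "a * t \<in> OK" "g * t \<in> OK" using inv_times_in_OK a(2) g(2) t(1) by auto
  have int: "integral_ideal d (ideal_scale (g * t) OK)"
    using O nz t0 by (intro integral_ideal_principal) auto
  have cop: "coprime_ideal d q (ideal_scale (g * t) OK)"
    unfolding coprime_ideal_iff[OF int]
    using t generator_in_principal by blast
  have "a / g = (a * t) / (g * t)" using t0 by simp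
  moreover have "a * t - g * t \<in> ideal_scale (real q) OK" using w by (auto simp: in_ideal_scale)
  moreover have "a * t \<noteq> 0" "g * t \<noteq> 0" using nz t0 by auto
  ultimately have "cong_one d q (a / g)" unfolding cong_one_def using O cop by blast
  moreover have "ideal_scale a b = ideal_scale (a / g) (ideal_scale g b)"
    using nz by (simp add: ideal_scale_scale)
  ultimately show ?thesis
    unfolding ray_equiv_def using totally_positive_divide[OF a(1) g(1)] by blast
qed

section \<open>Characters are constant on ray classes\<close>

lemma ideal_mult_principal:
  assumes "ok_module J" shows "ideal_mult (ideal_scale x OK) J = ideal_scale x J"
proof -
  have "z \<in> ideal_scale x J" if "z \<in> ideal_mult (ideal_scale x OK) J" for z
  proof -
    obtain n f g where z: "z = (\<Sum>i<(n::nat). f i * g i)" "\<forall>i<n. f i \<in> ideal_scale x OK \<and> g i \<in> J"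
      using \<open>z \<in> _\<close> by (auto simp: ideal_mult_def)
    have "f i * g i \<in> ideal_scale x J" if "i < n" for i
    proof -
      have "f i \<in> ideal_scale x OK" using z(2) that by blast
      then obtain y where "y \<in> OK" "f i = x * y" by (auto simp: in_ideal_scale)
      thus ?thesis unfolding in_ideal_scale using z(2) that ok_moduleD(3)[OF assms]
        by (intro bexI[of _ "y * g i"]) auto
    qed
    thus ?thesis unfolding z(1) by (intro ok_module_sum ok_module_scale assms) auto
  qed
  moreover have "z \<in> ideal_mult (ideal_scale x OK) J" if "z \<in> ideal_scale x J" for z
  proof -
    obtain y where y: "y \<in> J" "z = x * y"
      using \<open>z \<in> ideal_scale x J\<close> by (auto simp: in_ideal_scale)
    thus ?thesis unfolding ideal_mult_def
      using generator_in_principal by (intro CollectI exI[of _ 1] exI[of _ "\<lambda>_. x"] exI[of _ "\<lambda>_. y"]) auto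
  qed
  ultimately show ?thesis by blast
qed

lemma ideal_mult_commute: "ideal_mult I J = ideal_mult J I"
proof -
  have "ideal_mult I J \<subseteq> ideal_mult J I" for I J
  proof
    fix z assume "z \<in> ideal_mult I J"
    then obtain n f g where "z = (\<Sum>i<(n::nat). f i * g i)" "\<forall>i<n. f i \<in> I \<and> g i \<in> J"
      by (auto simp: ideal_mult_def)
    thus "z \<in> ideal_mult J I" unfolding ideal_mult_def
      by (intro CollectI exI[of _ n] exI[of _ g] exI[of _ f]) (simp add: mult.commute)
  qed
  thus ?thesis by blast
qed

lemma ideal_inv_principal:
  assumes "y \<in> K" "y \<noteq> 0" shows "ideal_inv d (ideal_scale y OK) = ideal_scale (1 / y) OK"
proof -
  have "z \<in> ideal_scale (1 / y) OK" if "z \<in> ideal_inv d (ideal_scale y OK)" for z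
  proof -
    have "z * (y * 1) \<in> OK" using that OK_1 unfolding ideal_inv_def ideal_scale_def by blast
    thus ?thesis using assms unfolding in_ideal_scale by (intro bexI[of _ "z * y"]) auto
  qed
  moreover have "z \<in> ideal_inv d (ideal_scale y OK)" if "z \<in> ideal_scale (1 / y) OK" for z
    using that assms by (auto simp: ideal_inv_def in_ideal_scale OK_K OK_mult intro!: K_divide)
  ultimately show ?thesis by blast
qed

text \<open>
  Write \<open>e = x/y\<close> as in the definition of the congruence; the numerator inherits coprimality to \<open>q\<close>
  from the denominator because \<open>x \<equiv> y\<close>.
\<close>

lemma principal_in_ideals_prime_to:
  assumes "cong_one d q e" shows "ideal_scale e OK \<in> ideals_prime_to d q"
proof -
  obtain x y z where xy: "x \<in> OK" "y \<in> OK" "x \<noteq> 0" "y \<noteq> 0" "e = x / y"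
      "coprime_ideal d q (ideal_scale y OK)" "z \<in> OK" "x - y = real q * z"
    using assms by (auto simp: cong_one_def in_ideal_scale)
  note int = integral_ideal_principal
  obtain u v where uv: "u \<in> OK" "v \<in> OK" "y * u + real q * v = 1"
    using xy coprime_ideal_iff[OF int[of y]] by (auto simp: in_ideal_scale)
  have "x * u + real q * (v - z * u) = (y * u + real q * v) + (x - y - real q * z) * u"
    by (simp add: algebra_simps)
  hence "x * u + real q * (v - z * u) = 1" using uv(3) xy(8) by simp
  hence copx: "coprime_ideal d q (ideal_scale x OK)" unfolding coprime_ideal_iff[OF int[OF xy(1,3)]]
    using uv xy by (intro bexI[of _ "x * u"] bexI[of _ "v - z * u"])
      (simp_all add: ok_moduleD(4)[OF ok_module_scale[OF ok_module_OK]] generator_in_principal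
        OK_diff OK_mult)
  have "ideal_mult (ideal_scale x OK) (ideal_inv d (ideal_scale y OK)) = ideal_scale e OK"
    using xy by (simp add: ideal_inv_principal OK_K ideal_mult_principal ok_module_scale ok_module_OK
        ideal_scale_scale)
  thus ?thesis unfolding ideals_prime_to_def
    using int xy copx by blast
qed

lemma integral_in_ideals_prime_to:
  assumes "integral_ideal d J" "coprime_ideal d q J" shows "J \<in> ideals_prime_to d q"
proof -
  have "ideal_inv d OK = OK" using ideal_inv_principal[of 1] by (simp add: ideal_scale_1 Rats_in_K)
  hence "ideal_mult J (ideal_inv d OK) = J"
    using ideal_mult_principal[OF ok_module_ideal[OF assms(1)], of 1]
    by (simp add: ideal_scale_1 ideal_mult_commute)
  moreover have "coprime_ideal d q OK"
    unfolding coprime_ideal_iff[OF integral_ideal_OK] using OK_1 OK_0 by force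
  ultimately show ?thesis using assms integral_ideal_OK unfolding ideals_prime_to_def by blast
qed

lemma character_ray_equiv:
  assumes "ray_class_character d q chi" "ray_equiv d q c J" "integral_ideal d J" "coprime_ideal d q J"
  shows "chi c = chi J"
proof -
  obtain e where e: "totally_positive d e" "cong_one d q e" "c = ideal_scale e J"
    using assms(2) by (auto simp: ray_equiv_def)
  have "chi (ideal_mult (ideal_scale e OK) J) = chi (ideal_scale e OK) * chi J"
    using assms(1) principal_in_ideals_prime_to[OF e(2)] integral_in_ideals_prime_to[OF assms(3,4)]
    unfolding ray_class_character_def by blast
  moreover have "chi (ideal_scale e OK) = 1" using e assms(1) by (auto simp: ray_class_character_def)
  ultimately show ?thesis
    using ideal_mult_principal[OF ok_module_ideal[OF assms(3)]] e(3) by simp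
qed

section \<open>Ideal norms and small elements\<close>

text \<open>
  The index of \<open>\<gamma>\<int>[\<surd>d]\<close> in \<open>\<int>[\<surd>d]\<close> is at most the absolute norm of \<open>\<gamma> = u + v\<surd>d\<close>. With \<open>g = gcd(u, v)\<close>,
  the lattice contains an element whose \<open>\<surd>d\<close>-coordinate is \<open>g\<close> (by Bezout) and the rational integer
  \<open>N(\<gamma>)/g = \<gamma>\<gamma>'/g\<close>; reducing first by one and then by the other leaves a box of \<open>g \<cdot> |N(\<gamma>)/g|\<close> points.
\<close>

lemma finite_reps_mod_principal:
  fixes u v :: int
  defines "N \<equiv> u\<^sup>2 - int d * v\<^sup>2"
  assumes "N \<noteq> 0"
  shows "\<exists>B. finite B \<and> card B \<le> nat \<bar>N\<bar> \<and>
           (\<forall>X Y. \<exists>i j. (i, j) \<in> B \<and> (\<exists>z\<in>sqrt_order.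
              of_int (X - i) + of_int (Y - j) * rt = (of_int u + of_int v * rt) * z))"
proof -
  define g where "g = gcd u v"
  have "u \<noteq> 0 \<or> v \<noteq> 0" using assms by auto
  hence g: "g > 0" by (simp add: g_def)
  obtain u' v' where uv: "u = g * u'" "v = g * v'" unfolding g_def by (metis dvdE gcd_dvd1 gcd_dvd2)
  define h where "h = u * u' - int d * v * v'"
  have N: "N = g * h" unfolding N_def h_def by (simp add: uv power2_eq_square algebra_simps)
  have h: "h \<noteq> 0" using assms(2) N by auto
  obtain s t where st: "s * v + t * u = g" using bezout_int[of v u] by (auto simp: g_def gcd.commute)
  define B where "B = {0..<\<bar>h\<bar>} \<times> {0..<g}"
  have "card B \<le> nat \<bar>N\<bar>" using g by (simp add: B_def N card_cartesian_product abs_mult nat_mult_distrib)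
  moreover have "\<exists>i j. (i, j) \<in> B \<and> (\<exists>z\<in>sqrt_order.
              of_int (X - i) + of_int (Y - j) * rt = (of_int u + of_int v * rt) * z)" for X Y
  proof -
    define k where "k = Y div g"
    define X1 where "X1 = X - k * (u * s + int d * v * t)"
    define l where "l = sgn h * (X1 div \<bar>h\<bar>)"
    have Y: "Y = Y mod g + g * k" by (simp add: k_def)
    have "X1 = X1 mod \<bar>h\<bar> + \<bar>h\<bar> * (X1 div \<bar>h\<bar>)" by simp
    also have "\<bar>h\<bar> = h * sgn h" by (simp add: abs_sgn)
    finally have X: "X1 = X1 mod \<bar>h\<bar> + h * l" unfolding l_def
      by (metis abs_sgn mult.assoc)
    define z where "z = of_int (k * s + l * u') + of_int (k * t - l * v') * rt"
    have "of_int (X - X1 mod \<bar>h\<bar>) + of_int (Y - Y mod g) * rt = (of_int u + of_int v * rt) * z"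
    proof -
      have a: "u * (k * s + l * u') + v * (k * t - l * v') * int d = X - X1 mod \<bar>h\<bar>"
        using X unfolding X1_def h_def by (simp add: algebra_simps)
      have "v * u' = u * v'" by (simp add: uv)
      hence "u * (k * t - l * v') + v * (k * s + l * u') = k * (s * v + t * u)"
        by (simp add: algebra_simps)
      also have "\<dots> = Y - Y mod g" using Y st by (simp add: mult.commute)
      finally have b: "u * (k * t - l * v') + v * (k * s + l * u') = Y - Y mod g" .
      have "(of_int u + of_int v * rt) * z
          = of_int (u * (k * s + l * u') + v * (k * t - l * v') * int d)
            + of_int (u * (k * t - l * v') + v * (k * s + l * u')) * rt"
        unfolding z_def mult_rep by (simp add: algebra_simps)
      thus ?thesis unfolding a b by simp
    qed
    moreover have "z \<in> sqrt_order" unfolding z_def by (rule sqrt_order_I)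
    moreover have "(X1 mod \<bar>h\<bar>, Y mod g) \<in> B" using g h by (simp add: B_def)
    ultimately show ?thesis by blast
  qed
  moreover have "finite B" by (simp add: B_def)
  ultimately show ?thesis by blast
qed

definition quotient_rel :: "real set \<Rightarrow> (real \<times> real) set" where
  "quotient_rel c = {(x, y). x \<in> OK \<and> y \<in> OK \<and> x - y \<in> c}"

lemma ideal_norm_alt: "ideal_norm d c = card (OK // quotient_rel c)"
  by (simp add: ideal_norm_def quotient_rel_def)

lemma equiv_quotient_rel:
  assumes "ok_module c" shows "equiv OK (quotient_rel c)"
proof (rule equivI)
  show "quotient_rel c \<subseteq> OK \<times> OK" by (auto simp: quotient_rel_def)
  show "refl_on OK (quotient_rel c)"
    using ok_moduleD(1)[OF assms] by (auto simp: quotient_rel_def refl_on_def)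
  show "sym (quotient_rel c)"
  proof (rule symI)
    fix x y assume xy: "(x, y) \<in> quotient_rel c"
    hence "x - y \<in> c" by (simp add: quotient_rel_def)
    from ok_moduleD(5)[OF assms ok_moduleD(1)[OF assms] this]
    show "(y, x) \<in> quotient_rel c" using xy by (simp add: quotient_rel_def)
  qed
  show "trans (quotient_rel c)"
  proof (rule transI)
    fix x y z assume xy: "(x, y) \<in> quotient_rel c" "(y, z) \<in> quotient_rel c"
    hence "x - y \<in> c" "y - z \<in> c" by (auto simp: quotient_rel_def)
    from ok_moduleD(2)[OF assms this] show "(x, z) \<in> quotient_rel c" using xy by (auto simp: quotient_rel_def)
  qed
qed

text \<open>
  Integers \<open>x\<close> are compared through \<open>2d x\<close>, which lies in \<open>\<int>[\<surd>d]\<close>; the scaled ideal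
  \<open>2d c\<close> contains \<open>\<gamma>\<int>[\<surd>d]\<close>, so the box for \<open>\<gamma>\<close> bounds the number of classes modulo \<open>c\<close>.
\<close>

lemma ideal_norm_le_sqrt_order:
  assumes c: "ok_module c" "c \<subseteq> OK" and N: "u\<^sup>2 - int d * v\<^sup>2 \<noteq> 0"
    and mem: "\<And>z. z \<in> sqrt_order \<Longrightarrow> \<exists>w\<in>c. (of_int u + of_int v * rt) * z = 2 * real d * w"
  shows "finite (OK // quotient_rel c)" "ideal_norm d c \<le> nat \<bar>u\<^sup>2 - int d * v\<^sup>2\<bar>"
proof -
  let ?N = "u\<^sup>2 - int d * v\<^sup>2" and ?Q = "OK // quotient_rel c"
  obtain B where B: "finite B" "card B \<le> nat \<bar>?N\<bar>"
    "\<And>X Y. \<exists>i j. (i, j) \<in> B \<and> (\<exists>z\<in>sqrt_order.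
       of_int (X - i) + of_int (Y - j) * rt = (of_int u + of_int v * rt) * z)"
    using finite_reps_mod_principal[OF N] by blast
  have rep: "\<exists>p\<in>B. \<exists>x\<in>A. A = quotient_rel c `` {x} \<and>
       (\<exists>w\<in>c. 2 * real d * x - (of_int (fst p) + of_int (snd p) * rt) = 2 * real d * w)"
    if "A \<in> ?Q" for A
  proof -
    obtain x where x: "x \<in> OK" "A = quotient_rel c `` {x}"
      using \<open>A \<in> ?Q\<close> by (auto elim: quotientE)
    have xA: "x \<in> A" using x ok_moduleD(1)[OF c(1)] by (auto simp: quotient_rel_def)
    obtain X Y where XY: "2 * real d * x = of_int X + of_int Y * rt"
      using OK_denominator[OF x(1)] sqrt_order_cases by blast
    obtain i j z where ij: "(i, j) \<in> B" "z \<in> sqrt_order"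
      "of_int (X - i) + of_int (Y - j) * rt = (of_int u + of_int v * rt) * z" using B(3) by blast
    obtain w where w: "w \<in> c" "(of_int u + of_int v * rt) * z = 2 * real d * w"
      using mem[OF ij(2)] by blast
    have "2 * real d * x - (of_int i + of_int j * rt) = of_int (X - i) + of_int (Y - j) * rt"
      unfolding XY by (simp add: algebra_simps)
    also have "\<dots> = 2 * real d * w" using ij(3) w(2) by simp
    finally show ?thesis using ij(1) w(1) x xA by (intro bexI[of _ "(i, j)"] bexI[of _ x]) auto
  qed
  then obtain f where f: "\<And>A. A \<in> ?Q \<Longrightarrow> f A \<in> B \<and> (\<exists>x\<in>A. A = quotient_rel c `` {x} \<and>
       (\<exists>w\<in>c. 2 * real d * x - (of_int (fst (f A)) + of_int (snd (f A)) * rt) = 2 * real d * w))"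
    by metis
  have "inj_on f ?Q"
  proof (rule inj_onI)
    fix A A' assume A: "A \<in> ?Q" "A' \<in> ?Q" "f A = f A'"
    obtain x w where x: "A = quotient_rel c `` {x}" "w \<in> c" "x \<in> A"
      "2 * real d * x - (of_int (fst (f A)) + of_int (snd (f A)) * rt) = 2 * real d * w"
      using f[OF A(1)] by blast
    obtain x' w' where x': "A' = quotient_rel c `` {x'}" "w' \<in> c" "x' \<in> A'"
      "2 * real d * x' - (of_int (fst (f A)) + of_int (snd (f A)) * rt) = 2 * real d * w'"
      using f[OF A(2)] A(3) by metis
    have "2 * real d * (x - x') = 2 * real d * (w - w')" using x(4) x'(4) by (simp add: algebra_simps)
    hence "x - x' = w - w'" using d_gt_1 by simp
    hence "x - x' \<in> c" using ok_moduleD(5)[OF c(1)] x x' by simp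
    moreover have "x \<in> OK" "x' \<in> OK" using x(1,3) x'(1,3) by (auto simp: quotient_rel_def)
    ultimately have "(x, x') \<in> quotient_rel c" by (simp add: quotient_rel_def)
    thus "A = A'" unfolding x(1) x'(1) by (rule equiv_class_eq[OF equiv_quotient_rel[OF c(1)]])
  qed
  note inj = this
  have sub: "f ` ?Q \<subseteq> B" using f by blast
  show "finite ?Q" using finite_imageD[OF finite_subset[OF sub B(1)] inj] .
  show "ideal_norm d c \<le> nat \<bar>?N\<bar>"
    unfolding ideal_norm_alt using card_inj_on_le[OF inj sub B(1)] B(2) by simp
qed

lemma nrm_int_rep: "nrm (of_int u + of_int v * rt) = of_int (u\<^sup>2 - int d * v\<^sup>2)"
  by (simp add: nrm_rep)

text \<open>
  The ideal \<open>a b\<close> contains the principal ideal \<open>(a t)\<close>. One factor \<open>2d\<close> brings \<open>a t\<close> into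
  \<open>\<int>[\<surd>d]\<close> and another one accounts for the scaling of the ideal; the norm of \<open>(2d)\<^sup>2\<close> is \<open>(2d)\<^sup>4\<close>.
  The bound depends on \<open>a\<close> only through its norm.
\<close>

lemma ideal_norm_le:
  assumes b: "ok_module b" "t \<in> b" "t \<in> K" "t \<noteq> 0" and a: "a \<in> K" "a \<noteq> 0"
    and c: "ideal_scale a b \<subseteq> OK"
  shows "finite (OK // quotient_rel (ideal_scale a b))"
    "real (ideal_norm d (ideal_scale a b)) \<le> (2 * real d) ^ 4 * \<bar>nrm t\<bar> * \<bar>nrm a\<bar>"
proof -
  have "a * t \<in> ideal_scale a b" using b by (auto simp: in_ideal_scale)
  hence at: "a * t \<in> OK" using c by blast
  obtain u0 v0 where uv0: "2 * real d * (a * t) = of_int u0 + of_int v0 * rt"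
    using OK_denominator[OF at] sqrt_order_cases by blast
  define u v where "u = 2 * int d * u0" and "v = 2 * int d * v0"
  have uv: "of_int u + of_int v * rt = (2 * real d) * ((2 * real d) * (a * t))"
    unfolding uv0 u_def v_def by (simp add: algebra_simps)
  have D: "2 * real d \<in> \<rat>" by simp
  have nD: "nrm (2 * real d) = (2 * real d)\<^sup>2"
    by (simp only: nrm_def cj_Rats[OF D] power2_eq_square)
  have nmult: "nrm (2 * real d * x) = (2 * real d)\<^sup>2 * nrm x" if "x \<in> K" for x
    unfolding nrm_mult[OF Rats_in_K[OF D] that] nD ..
  have atK: "a * t \<in> K" "2 * real d * (a * t) \<in> K"
    using a(1) b(3) K_mult_cj(1)[OF Rats_in_K[OF D]] K_mult_cj(1) by auto
  have "nrm (of_int u + of_int v * rt) = (2 * real d)\<^sup>2 * ((2 * real d)\<^sup>2 * (nrm a * nrm t))"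
    unfolding uv nmult[OF atK(2)] nmult[OF atK(1)] nrm_mult[OF a(1) b(3)] ..
  also have "\<dots> = (2 * real d) ^ 4 * (nrm a * nrm t)"
    by (simp add: power2_eq_square power4_eq_xxxx)
  finally have "nrm (of_int u + of_int v * rt) = (2 * real d) ^ 4 * (nrm a * nrm t)" .
  hence n: "real_of_int (u\<^sup>2 - int d * v\<^sup>2) = (2 * real d) ^ 4 * (nrm a * nrm t)"
    unfolding nrm_int_rep .
  hence "real_of_int (u\<^sup>2 - int d * v\<^sup>2) \<noteq> 0" using a b d_gt_1 by (simp add: nrm_eq_0)
  hence nz: "u\<^sup>2 - int d * v\<^sup>2 \<noteq> 0" by (metis of_int_0)
  have mem: "\<exists>w\<in>ideal_scale a b. (of_int u + of_int v * rt) * z = 2 * real d * w"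
    if "z \<in> sqrt_order" for z
  proof (intro bexI)
    have "(2 * real d) * z \<in> OK" using OK_mult[OF _ OK_sqrt_order[OF that], of "2 * real d"]
        OK_of_nat[of "2 * d"] by simp
    thus "a * ((2 * real d * z) * t) \<in> ideal_scale a b"
      using ok_moduleD(3)[OF b(1) _ b(2)] by (auto simp: in_ideal_scale)
  qed (simp add: uv)
  note * = ideal_norm_le_sqrt_order[OF ok_module_scale[OF b(1)] c nz mem]
  show "finite (OK // quotient_rel (ideal_scale a b))" by (rule *(1))
  have "real (ideal_norm d (ideal_scale a b)) \<le> real (nat \<bar>u\<^sup>2 - int d * v\<^sup>2\<bar>)"
    using *(2) by (simp only: of_nat_le_iff)
  also have "\<dots> = \<bar>real_of_int (u\<^sup>2 - int d * v\<^sup>2)\<bar>" by simp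
  also have "\<dots> = (2 * real d) ^ 4 * \<bar>nrm t\<bar> * \<bar>nrm a\<bar>" unfolding n by (simp add: abs_mult)
  finally show "real (ideal_norm d (ideal_scale a b)) \<le> (2 * real d) ^ 4 * \<bar>nrm t\<bar> * \<bar>nrm a\<bar>" .
qed

lemma ideal_norm_pos: "finite (OK // quotient_rel c) \<Longrightarrow> ideal_norm d c > 0"
  using OK_1 unfolding ideal_norm_alt card_gt_0_iff quotient_def by blast

text \<open>
  The box \<open>0 \<le> i, j \<le> floor(\<surd>n)\<close> has more than \<open>n\<close> points \<open>i + j\<surd>d\<close>, so two of them are
  congruent modulo the ideal.
\<close>

lemma small_element:
  assumes c: "ok_module c" and fin: "finite (OK // quotient_rel c)"
  shows "\<exists>x y :: int. (x, y) \<noteq> (0, 0) \<and> x\<^sup>2 \<le> int (ideal_norm d c) \<and> y\<^sup>2 \<le> int (ideal_norm d c) \<and>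
           of_int x + of_int y * rt \<in> c"
proof -
  define n where "n = ideal_norm d c"
  define m where "m = floor_sqrt n"
  define B where "B = {0..int m} \<times> {0..int m}"
  define f where "f = (\<lambda>(i :: int, j :: int). quotient_rel c `` {of_int i + of_int j * rt})"
  have OK: "of_int i + of_int j * rt \<in> OK" for i j by (intro OK_sqrt_order sqrt_order_I)
  have "f ` B \<subseteq> OK // quotient_rel c" using OK by (auto simp: f_def intro: quotientI)
  hence "card (f ` B) \<le> n" unfolding n_def ideal_norm_alt using fin by (rule card_mono[rotated])
  also have "n < (Suc m)\<^sup>2" unfolding m_def by (rule Suc_floor_sqrt_power2_gt)
  also have "(Suc m)\<^sup>2 = card B"
    by (simp add: B_def card_cartesian_product power2_eq_square nat_add_distrib)
  finally have "\<not> inj_on f B" using pigeonhole by blast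
  then obtain i j k l where ij: "(i, j) \<in> B" "(k, l) \<in> B" "(i, j) \<noteq> (k, l)" "f (i, j) = f (k, l)"
    unfolding inj_on_def by auto
  have "(of_int i + of_int j * rt, of_int k + of_int l * rt) \<in> quotient_rel c"
    using ij(4) eq_equiv_class[OF _ equiv_quotient_rel[OF c] OK] by (simp add: f_def)
  hence "of_int (i - k) + of_int (j - l) * rt \<in> c" by (simp add: quotient_rel_def algebra_simps)
  moreover have "(i - k)\<^sup>2 \<le> int n" "(j - l)\<^sup>2 \<le> int n"
  proof -
    have "int m ^ 2 \<le> int n" unfolding m_def
      by (metis floor_sqrt_power2_le of_nat_le_iff of_nat_power)
    moreover have "\<bar>i - k\<bar> \<le> int m" "\<bar>j - l\<bar> \<le> int m" using ij by (auto simp: B_def)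
    ultimately show "(i - k)\<^sup>2 \<le> int n" "(j - l)\<^sup>2 \<le> int n"
      by (metis abs_le_square_iff abs_of_nat order_trans)+
  qed
  ultimately show ?thesis using ij(3) unfolding n_def
    by (intro exI[of _ "i - k"] exI[of _ "j - l"]) auto
qed

text \<open>
  The number \<open>N\<close> is the norm of \<open>2d w\<close>, hence divisible by \<open>2d w\<close>. If the coordinates of \<open>2d w\<close> and \<open>2d w'\<close>
  agree modulo \<open>N\<close>, then \<open>2d (w' - w)\<close> is divisible by \<open>2d w\<close>, and so \<open>w\<close> divides \<open>w'\<close>. Exchanging the roles of
  two elements of equal norm shows that they are associates, so there are only finitely many
  classes of elements of bounded norm.
\<close>

lemma quotient_integral_if_cong_norm:
  fixes u v u' v' :: int
  defines "N \<equiv> u\<^sup>2 - int d * v\<^sup>2"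
  assumes w: "w \<in> OK" "2 * real d * w = of_int u + of_int v * rt" "w \<noteq> 0"
    and w': "w' \<in> OK" "2 * real d * w' = of_int u' + of_int v' * rt"
    and cong: "u' mod N = u mod N" "v' mod N = v mod N"
  shows "w' / w \<in> OK"
proof -
  obtain k where k: "u' - u = N * k" using cong(1) by (metis dvdE mod_eq_dvd_iff)
  obtain l where l: "v' - v = N * l" using cong(2) by (metis dvdE mod_eq_dvd_iff)
  have wK: "w \<in> K" using w OK_K by blast
  have D: "2 * real d \<in> \<rat>" "2 * real d \<noteq> 0" using d_gt_1 by simp_all
  have N: "of_int N = (2 * real d) * (2 * real d) * (w * cj w)"
  proof -
    have "of_int N = nrm (2 * real d * w)" unfolding w(2) nrm_int_rep N_def ..
    also have "\<dots> = nrm (2 * real d) * nrm w" by (intro nrm_mult Rats_in_K D wK)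
    finally show ?thesis by (simp only: nrm_def cj_Rats[OF D(1)])
  qed
  have "2 * real d * (w' - w) = of_int (u' - u) + of_int (v' - v) * rt"
    using w(2) w'(2) by (simp add: algebra_simps)
  also have "\<dots> = of_int N * (of_int k + of_int l * rt)" unfolding k l by (simp add: algebra_simps)
  also have "\<dots> = 2 * real d * (w * (2 * real d * (cj w * (of_int k + of_int l * rt))))"
    unfolding N by (simp only: mult_ac)
  finally have "w' - w = w * (2 * real d * (cj w * (of_int k + of_int l * rt)))" using D(2) by simp
  hence "w' / w = 1 + 2 * real d * (cj w * (of_int k + of_int l * rt))"
    using w(3) by (simp add: field_simps)
  moreover have "2 * real d \<in> OK" using OK_of_nat[of "2 * d"] by simp
  ultimately show ?thesis
    using w(1) OK_sqrt_order[OF sqrt_order_I[of k l]] by (simp add: OK_add OK_mult OK_1 OK_cj)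
qed

section \<open>Absolute convergence\<close>

text \<open>
  This encodes an ideal \<open>c = a b\<close> of norm \<open>n\<close> by bounded data: \<open>w\<close> is the quotient of a small element
  \<open>x + y\<surd>d\<close> of \<open>c\<close> by \<open>a\<close>. Its norm is at most \<open>(1 + d)n\<close> divided by the absolute norm of \<open>a\<close>, and that
  quotient is bounded by the index estimate.
\<close>

lemma small_multiple:
  assumes b: "integral_ideal d b" "t \<in> b" "t \<noteq> 0"
    and c: "integral_ideal d c" "principally_equiv d c b"
  defines "n \<equiv> ideal_norm d c"
  shows "\<exists>x y u v w. (x, y) \<noteq> (0 :: int, 0 :: int) \<and> x\<^sup>2 \<le> int n \<and> y\<^sup>2 \<le> int n \<and> n > 0 \<and>
    w \<in> b \<and> w \<noteq> 0 \<and> 2 * real d * w = of_int u + of_int v * rt \<and>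
    c = ideal_scale ((of_int x + of_int y * rt) / w) b \<and>
    \<bar>u\<^sup>2 - int d * v\<^sup>2\<bar> \<le> \<lceil>(1 + real d) * (2 * real d) ^ 6 * \<bar>nrm t\<bar>\<rceil>"
proof -
  obtain a where a: "a \<in> K" "a \<noteq> 0" "c = ideal_scale a b"
    using c(2) by (auto simp: principally_equiv_def)
  have modb: "ok_module b" using ok_module_ideal[OF b(1)] .
  have tK: "t \<in> K" using integral_ideal_subset[OF b(1,2)] OK_K by blast
  have sub: "ideal_scale a b \<subseteq> OK" using c(1) a(3) by (auto simp: integral_ideal_def)
  note le = ideal_norm_le[OF modb b(2) tK b(3) a(1,2) sub]
  have fin: "finite (OK // quotient_rel c)" using le(1) a(3) by simp
  have npos: "n > 0" unfolding n_def using fin by (rule ideal_norm_pos)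
  obtain x y :: int where xy: "(x, y) \<noteq> (0, 0)" "x\<^sup>2 \<le> int n" "y\<^sup>2 \<le> int n"
      "of_int x + of_int y * rt \<in> c"
    using small_element[OF ok_module_ideal[OF c(1)] fin] unfolding n_def by blast
  define be where "be = of_int x + of_int y * rt"
  obtain w where w: "w \<in> b" "be = a * w" using xy(4) a(3) by (auto simp: in_ideal_scale be_def)
  have be0: "be \<noteq> 0"
    using field_rep_unique[of "of_int x" "of_int y" 0 0] xy(1) by (auto simp: be_def)
  have w0: "w \<noteq> 0" using be0 w(2) by auto
  have wO: "w \<in> OK" using integral_ideal_subset[OF b(1) w(1)] .
  obtain u v where uv: "2 * real d * w = of_int u + of_int v * rt"
    using OK_denominator[OF wO] sqrt_order_cases by blast
  have D: "2 * real d \<in> \<rat>" by simp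
  have "\<bar>nrm a\<bar> * \<bar>nrm w\<bar> = \<bar>nrm be\<bar>"
    unfolding w(2) nrm_mult[OF a(1) OK_K[OF wO]] by (simp add: abs_mult)
  also have "\<bar>nrm be\<bar> \<le> (of_int x)\<^sup>2 + real d * (of_int y)\<^sup>2"
    unfolding be_def nrm_int_rep by simp (smt (verit) mult_nonneg_nonneg of_nat_0_le_iff zero_le_power2)
  also have "\<dots> \<le> real n + real d * real n"
  proof (intro add_mono mult_left_mono)
    show "(of_int x)\<^sup>2 \<le> real n" "(of_int y)\<^sup>2 \<le> real n"
      using xy(2,3) by (metis of_int_le_iff of_int_of_nat_eq of_int_power)+
  qed simp
  also have "\<dots> = (1 + real d) * real n" by (simp add: algebra_simps)
  also have "\<dots> \<le> (1 + real d) * ((2 * real d) ^ 4 * \<bar>nrm t\<bar> * \<bar>nrm a\<bar>)"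
    using le(2) a(3) by (intro mult_left_mono) (auto simp: n_def)
  finally have "\<bar>nrm a\<bar> * \<bar>nrm w\<bar> \<le> \<bar>nrm a\<bar> * ((1 + real d) * (2 * real d) ^ 4 * \<bar>nrm t\<bar>)"
    by (simp add: mult_ac)
  moreover have "\<bar>nrm a\<bar> > 0" using nrm_eq_0[OF a(1)] a(2) by simp
  ultimately have nw: "\<bar>nrm w\<bar> \<le> (1 + real d) * (2 * real d) ^ 4 * \<bar>nrm t\<bar>" by simp
  have "\<bar>real_of_int (u\<^sup>2 - int d * v\<^sup>2)\<bar> = \<bar>nrm (2 * real d * w)\<bar>"
    unfolding uv nrm_int_rep ..
  also have "nrm (2 * real d * w) = (2 * real d)\<^sup>2 * nrm w"
    unfolding nrm_mult[OF Rats_in_K[OF D] OK_K[OF wO]]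
    by (simp only: nrm_def cj_Rats[OF D] power2_eq_square)
  also have "\<bar>\<dots>\<bar> = (2 * real d)\<^sup>2 * \<bar>nrm w\<bar>" by (simp add: abs_mult)
  also have "\<dots> \<le> (2 * real d)\<^sup>2 * ((1 + real d) * (2 * real d) ^ 4 * \<bar>nrm t\<bar>)"
    using nw by (intro mult_left_mono) auto
  also have "\<dots> = (1 + real d) * (2 * real d) ^ 6 * \<bar>nrm t\<bar>"
    using power_add[of "2 * real d" 2 4] by simp
  finally have "\<bar>u\<^sup>2 - int d * v\<^sup>2\<bar> \<le> \<lceil>(1 + real d) * (2 * real d) ^ 6 * \<bar>nrm t\<bar>\<rceil>"
    by linarith
  moreover have "be / w = a" using w(2) w0 by simp
  hence "c = ideal_scale ((of_int x + of_int y * rt) / w) b" using a(3) be_def by simp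
  ultimately show ?thesis using xy npos w(1) w0 uv by blast
qed

text \<open>
  The map \<open>key\<close> is injective because equal keys make the two values of \<open>w\<close> associates. It takes values in
  \<open>\<int> \<times> \<int>\<close> times a finite set, and \<open>n \<ge> max(1,|x|) max(1,|y|)\<close> bounds the terms.
\<close>

lemma summable_ideal_norm_powr:
  assumes b: "integral_ideal d b" and \<sigma>: "\<sigma> > 1"
  shows "(\<lambda>c. real (ideal_norm d c) powr - \<sigma>) summable_on
           {c. integral_ideal d c \<and> principally_equiv d c b}" (is "?h summable_on ?S")
proof -
  obtain t where t: "t \<in> b" "t \<noteq> 0" using integral_ideal_nonzero b by blast
  define C where "C = \<lceil>(1 + real d) * (2 * real d) ^ 6 * \<bar>nrm t\<bar>\<rceil>"
  obtain x y u v w where data: "\<And>c. c \<in> ?S \<Longrightarrow>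
    (x c, y c) \<noteq> (0 :: int, 0 :: int) \<and> (x c)\<^sup>2 \<le> int (ideal_norm d c) \<and>
    (y c)\<^sup>2 \<le> int (ideal_norm d c) \<and> ideal_norm d c > 0 \<and>
    w c \<in> b \<and> w c \<noteq> 0 \<and> 2 * real d * w c = of_int (u c) + of_int (v c) * rt \<and>
    c = ideal_scale ((of_int (x c) + of_int (y c) * rt) / w c) b \<and>
    \<bar>(u c)\<^sup>2 - int d * (v c)\<^sup>2\<bar> \<le> C"
    using small_multiple[OF b t] unfolding C_def[symmetric] mem_Collect_eq by metis
  define N where "N = (\<lambda>c. (u c)\<^sup>2 - int d * (v c)\<^sup>2)"
  define key where "key = (\<lambda>c. (x c, y c, N c, u c mod N c, v c mod N c))"
  have wO: "w c \<in> OK" if "c \<in> ?S" for c using data[OF that] integral_ideal_subset[OF b] by blast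
  have N0: "N c \<noteq> 0" if "c \<in> ?S" for c
  proof -
    have D: "2 * real d \<in> K" "2 * real d \<noteq> 0" using d_gt_1 by (simp_all add: Rats_in_K)
    have "nrm (2 * real d * w c) \<noteq> 0"
      using D(2) data[OF that] nrm_eq_0[OF K_mult_cj(1)[OF D(1) OK_K[OF wO[OF that]]]]
      by (metis mult_eq_0_iff)
    moreover have "nrm (2 * real d * w c) = of_int (N c)"
      using data[OF that] unfolding N_def by (simp only: nrm_int_rep)
    ultimately show ?thesis by auto
  qed
  have inj: "inj_on key ?S"
  proof (rule inj_onI)
    fix c c' assume c: "c \<in> ?S" "c' \<in> ?S" and eq: "key c = key c'"
    have eqs: "x c' = x c" "y c' = y c" "N c' = N c" "u c' mod N c = u c mod N c"
      "v c' mod N c = v c mod N c" using eq by (auto simp: key_def)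
    note dc = data[OF c(1)] and dc' = data[OF c(2)]
    have "w c' / w c \<in> OK" "w c / w c' \<in> OK"
      using quotient_integral_if_cong_norm[of "w c" "u c" "v c" "w c'" "u c'" "v c'"]
        quotient_integral_if_cong_norm[of "w c'" "u c'" "v c'" "w c" "u c" "v c"]
        wO c dc dc' eqs unfolding N_def by auto
    moreover have "w c' / w c * (w c / w c') = 1" using dc dc' by simp
    ultimately have "w c' / w c \<in> unit_group d" unfolding unit_group_def by blast
    from unit_scale[OF this ok_module_ideal[OF b]]
    have "ideal_scale (w c' / w c) b = b" .
    hence "c' = ideal_scale ((of_int (x c') + of_int (y c') * rt) / w c') (ideal_scale (w c' / w c) b)"
      using dc' by simp
    also have "\<dots> = c" using dc dc' eqs by (simp add: ideal_scale_scale)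
    finally show "c = c'" by simp
  qed
  define f where "f = (\<lambda>i::int. of_int (max 1 \<bar>i\<bar>) powr - \<sigma> :: real)"
  define T where "T = {-C..C} \<times> {-C..C} \<times> {-C..C}"
  define G where "G = (\<lambda>(i, j, k :: int \<times> int \<times> int). f i * f j)"
  have f: "f summable_on UNIV" unfolding f_def by (rule summable_on_int_powr[OF \<sigma>])
  have f0: "f i \<ge> 0" for i by (simp add: f_def)
  have "((\<lambda>k. G (i, j, k)) has_sum (of_nat (card T) * f j * f i)) T" for i j
    using has_sum_constant[of T "f i * f j"] by (simp add: T_def G_def mult_ac)
  hence inner: "((\<lambda>k. (\<lambda>p. G (i, p)) (j, k)) has_sum (of_nat (card T) * f j * f i)) T" for i j
    by simp
  define I where "I = infsum f UNIV"
  have I: "(f has_sum I) UNIV" unfolding I_def using f by (rule has_sum_infsum)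
  have row: "((\<lambda>j. of_nat (card T) * f j * f i) has_sum (of_nat (card T) * I * f i)) UNIV" for i
    by (intro has_sum_cmult_left has_sum_cmult_right I)
  have G0: "G p \<ge> 0" for p using f0 by (auto simp: G_def split: prod.splits)
  have "(\<lambda>p. G (i, p)) summable_on (UNIV \<times> T)" for i
    using row[of i] by (intro summable_on_SigmaI[OF inner _ G0]) (auto simp: summable_on_def)
  hence "((\<lambda>p. G (i, p)) has_sum (of_nat (card T) * I * f i)) (UNIV \<times> T)" for i
    by (intro has_sum_SigmaI[OF inner row])
  moreover have "(\<lambda>i. of_nat (card T) * I * f i) summable_on UNIV"
    by (intro summable_on_cmult_right f)
  ultimately have "G summable_on (UNIV \<times> UNIV \<times> T)"
    by (rule summable_on_SigmaI[OF _ _ G0])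
  moreover have sub: "key ` ?S \<subseteq> UNIV \<times> UNIV \<times> T"
  proof
    fix p assume "p \<in> key ` ?S"
    then obtain c where c: "c \<in> ?S" "p = key c" by blast
    have "\<bar>N c\<bar> \<le> C" using data[OF c(1)] by (simp add: N_def)
    moreover have "\<bar>i mod N c\<bar> \<le> \<bar>N c\<bar>" for i using N0[OF c(1)] abs_mod_less[of "N c" i] by simp
    ultimately show "p \<in> UNIV \<times> UNIV \<times> T" unfolding c(2) key_def T_def
      by (simp add: abs_le_iff) (smt (verit))
  qed
  ultimately have "G summable_on (key ` ?S)" by (rule summable_on_subset_banach)
  hence "(G \<circ> key) summable_on ?S" by (simp add: summable_on_reindex[OF inj])
  thus ?thesis
  proof (rule summable_on_comparison_test)
    fix c assume c: "c \<in> ?S"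
    define n where "n = ideal_norm d c"
    have n1: "1 \<le> int n" using data[OF c] by (simp add: n_def)
    have sq: "(max 1 \<bar>i\<bar>)\<^sup>2 \<le> int n" if "i\<^sup>2 \<le> int n" for i
      using that n1 by (auto simp: max_def)
    have "(max 1 \<bar>x c\<bar> * max 1 \<bar>y c\<bar>)\<^sup>2 \<le> int n * int n"
      unfolding power_mult_distrib using data[OF c] n1
      by (intro mult_mono sq) (auto simp: n_def)
    hence "max 1 \<bar>x c\<bar> * max 1 \<bar>y c\<bar> \<le> int n"
      unfolding power2_eq_square[symmetric, of "int n"] by (rule power2_le_imp_le) simp
    hence le: "real_of_int (max 1 \<bar>x c\<bar> * max 1 \<bar>y c\<bar>) \<le> real n" by linarith
    have pos: "real_of_int (max 1 \<bar>x c\<bar> * max 1 \<bar>y c\<bar>) > 0" by simp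
    have "real n powr - \<sigma> \<le> real_of_int (max 1 \<bar>x c\<bar> * max 1 \<bar>y c\<bar>) powr - \<sigma>"
      by (rule powr_mono2'[OF _ pos le]) (use \<sigma> in simp)
    also have "\<dots> = (G \<circ> key) c"
      unfolding o_def key_def G_def f_def prod.case of_int_mult by (rule powr_mult)
    finally show "?h c \<le> (G \<circ> key) c" by (simp add: n_def)
  qed simp
qed

lemma summable_partial_zeta:
  assumes "integral_ideal d b" "Re s > 1"
  shows "(\<lambda>c. of_nat (ideal_norm d c) powr - s :: complex) summable_on
           {c. integral_ideal d c \<and> principally_equiv d c b}"
proof (rule abs_summable_summable)
  have *: "norm (of_nat n powr - s :: complex) = real n powr - Re s" for n
    using norm_powr_real_powr[of "of_nat n" "- s"] by simp
  show "(\<lambda>c. norm (of_nat (ideal_norm d c) powr - s :: complex)) summable_on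
      {c. integral_ideal d c \<and> principally_equiv d c b}"
    unfolding * by (rule summable_ideal_norm_powr[OF assms])
qed

end

section \<open>The residues \<open>C + D\<delta>\<close> and the action of the units\<close>

locale ray_setting = real_quadratic +
  fixes q :: nat and b :: "real set" and \<delta> :: real
  assumes q_gt_1: "q > 1"
    and b_integral: "integral_ideal d b"
    and inv_lattice: "ideal_inv d b = lattice \<delta>"
    and \<delta>_pos: "totally_positive d \<delta>"
begin

abbreviation "binv \<equiv> ideal_inv d b"
abbreviation "congr \<equiv> cong_inv q b"

text \<open>The lattice \<open>[1,\<delta>]\<close> is closed under multiplication by \<open>\<surd>d\<close>, hence not contained in \<open>\<rat>\<close>.\<close>

lemma \<delta>_irrational: "\<delta> \<notin> \<rat>"
proof
  assume "\<delta> \<in> \<rat>"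
  moreover have "rt \<in> binv"
    using rt_in_K OK_mult[OF OK_rt] integral_ideal_subset[OF b_integral] by (auto simp: ideal_inv_def)
  ultimately have "rt \<in> \<rat>" unfolding inv_lattice lattice_def by auto
  thus False using sqrt_irrational by simp
qed

lemma elt_in_binv: "elt \<delta> p \<in> binv"
  unfolding inv_lattice lattice_def elt_def by blast

text \<open>This is where total positivity of \<open>\<delta>\<close> enters: the ideal \<open>(C + D\<delta>)b\<close> lies in the narrow
  class of \<open>b\<close> for every nonzero residue.\<close>

lemma elt_totally_positive:
  assumes "p \<in> residue_pairs q" shows "totally_positive d (elt \<delta> p)"
proof -
  obtain C D where p: "p = (C, D)" "C \<ge> 0" "D \<ge> 0" "C > 0 \<or> D > 0"
    using assms by (cases p) (auto simp: residue_pairs_def)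
  note \<delta> = totally_positiveD[OF \<delta>_pos]
  have K: "of_int C \<in> K" "of_int D \<in> K" "of_int D * \<delta> \<in> K"
    using Rats_in_K K_mult_cj(1) \<delta>(1) by auto
  have "cj (of_int C + of_int D * \<delta>) = of_int C + of_int D * cj \<delta>"
    using K \<delta>(1) by (simp add: K_add_cj K_mult_cj cj_Rats)
  moreover have "of_int C + of_int D * z > 0" if "z > 0" for z :: real
    using p that by (auto intro: add_pos_nonneg add_nonneg_pos)
  ultimately show ?thesis
    unfolding totally_positive_def elt_def p(1) fst_conv snd_conv using K K_add_cj(1) \<delta> by simp
qed

lemma elt_reduce:
  assumes "x \<in> binv"
  obtains p where "p \<in> insert (0, 0) (residue_pairs q)" "congr x (elt \<delta> p)"
proof -
  obtain m n where x: "x = of_int m + of_int n * \<delta>"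
    using assms unfolding inv_lattice lattice_def by blast
  define p where "p = (m mod int q, n mod int q)"
  have "x - elt \<delta> p = of_int (m - m mod int q) + of_int (n - n mod int q) * \<delta>"
    by (simp add: x p_def elt_def algebra_simps)
  also have "\<dots> = real q * elt \<delta> (m div int q, n div int q)"
    unfolding minus_mod_eq_mult_div elt_def by (simp add: algebra_simps)
  finally have "congr x (elt \<delta> p)" using elt_in_binv by (auto simp: in_ideal_scale)
  moreover have "p \<in> insert (0, 0) (residue_pairs q)"
    using q_gt_1 by (auto simp: p_def residue_pairs_def)
  ultimately show ?thesis using that by blast
qed

lemma elt_cong_unique:
  assumes "p \<in> residue_pairs q" "p' \<in> residue_pairs q" "congr (elt \<delta> p) (elt \<delta> p')"
  shows "p = p'"
proof -
  obtain A B where p: "p = (A, B)" "0 \<le> A" "A < int q" "0 \<le> B" "B < int q"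
    using assms(1) by (cases p) (auto simp: residue_pairs_def)
  obtain A' B' where p': "p' = (A', B')" "0 \<le> A'" "A' < int q" "0 \<le> B'" "B' < int q"
    using assms(2) by (cases p') (auto simp: residue_pairs_def)
  obtain m n where "elt \<delta> p - elt \<delta> p' = real q * (of_int m + of_int n * \<delta>)"
    using assms(3) unfolding in_ideal_scale inv_lattice lattice_def by blast
  hence eq: "of_int (A - A' - int q * m) = of_int (int q * n - (B - B')) * \<delta>"
    by (simp add: p p' elt_def algebra_simps)
  have n: "int q * n - (B - B') = 0"
  proof (rule ccontr)
    assume "int q * n - (B - B') \<noteq> 0"
    hence "real_of_int (int q * n - (B - B')) \<noteq> 0" by (simp only: of_int_eq_0_iff not_False_eq_True)
    hence "\<delta> = of_int (A - A' - int q * m) / of_int (int q * n - (B - B'))"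
      using eq by (metis nonzero_mult_div_cancel_left)
    also have "\<dots> \<in> \<rat>" by (intro Rats_divide Rats_of_int)
    finally show False using \<delta>_irrational by simp
  qed
  have "real_of_int (A - A' - int q * m) = 0" using eq by (simp only: n of_int_0 mult_zero_left)
  hence "A - A' - int q * m = 0" by (simp only: of_int_eq_0_iff)
  hence "A - A' = int q * m" "B - B' = int q * n" using n by simp_all
  hence "B mod int q = B' mod int q" "A mod int q = A' mod int q"
    by (metis mod_eq_dvd_iff dvd_triv_left)+
  thus ?thesis using p p' by simp
qed

lemma not_cong_zero:
  assumes "x \<in> binv" "integral_ideal d (ideal_scale x b)" "coprime_ideal d q (ideal_scale x b)"
  shows "\<not> congr x 0"
proof
  assume 0: "congr x 0"
  obtain t y where t: "t \<in> b" "y \<in> OK" "x * t + real q * y = 1"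
    using assms(3) coprime_ideal_iff[OF assms(2)] by (auto simp: in_ideal_scale)
  obtain z where z: "z \<in> OK" "x * t = real q * z" using cong_inv_times[OF 0 t(1)] by auto
  have "real q * (z + y) = 1" using t(3) z(2) by (simp add: algebra_simps)
  thus False using inverse_nat_notin_OK[OF q_gt_1 OK_add[OF z(1) t(2)]] by simp
qed

lemma scale_integral: "totally_positive d x \<Longrightarrow> x \<in> binv \<Longrightarrow> integral_ideal d (ideal_scale x b)"
  using integral_ideal_scale_iff[OF b_integral] totally_positiveD by blast

lemma residue_pairs_coprimeD:
  assumes "p \<in> residue_pairs_coprime d q b \<delta>"
  shows "p \<in> residue_pairs q" "coprime_ideal d q (ideal_scale (elt \<delta> p) b)"
    "totally_positive d (elt \<delta> p)" "integral_ideal d (ideal_scale (elt \<delta> p) b)"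
  using assms elt_totally_positive scale_integral elt_in_binv
  by (auto simp: residue_pairs_coprime_def)

lemma coprime_residue:
  assumes x: "totally_positive d x" "x \<in> binv" "coprime_ideal d q (ideal_scale x b)"
  obtains p where "p \<in> residue_pairs_coprime d q b \<delta>" "congr x (elt \<delta> p)"
proof -
  obtain p where p: "p \<in> insert (0, 0) (residue_pairs q)" "congr x (elt \<delta> p)"
    using elt_reduce[OF x(2)] by blast
  have int: "integral_ideal d (ideal_scale x b)" using scale_integral x by blast
  have "p \<noteq> (0, 0)" using not_cong_zero[OF x(2) int x(3)] p(2) by (auto simp: elt_def)
  hence pr: "p \<in> residue_pairs q" using p(1) by blast
  have "coprime_ideal d q (ideal_scale (elt \<delta> p) b)"
    using coprime_cong_inv[OF b_integral scale_integral[OF elt_totally_positive[OF pr] elt_in_binv]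
        int cong_inv_sym[OF p(2)] x(3)] .
  thus ?thesis using that[of p] pr p(2) by (simp add: residue_pairs_coprime_def)
qed

lemma pos_unitsD:
  assumes "u \<in> pos_units d" shows "u \<in> OK" "u \<in> unit_group d" "totally_positive d u"
  using assms by (auto simp: pos_units_def unit_group_def)

text \<open>The residues are pairwise incongruent, so the definite description has at most one solution.\<close>

lemma unit_act_eqI:
  assumes "p' \<in> residue_pairs q" "congr (elt \<delta> p * u) (elt \<delta> p')"
  shows "unit_act d q b \<delta> u p = p'"
  unfolding unit_act_def
proof (rule the_equality)
  fix p'' assume p'': "p'' \<in> residue_pairs q \<and> congr (elt \<delta> p * u) (elt \<delta> p'')"
  hence "congr (elt \<delta> p'') (elt \<delta> p')"
    using cong_inv_trans[OF cong_inv_sym] assms(2) by blast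
  thus "p'' = p'" using elt_cong_unique p'' assms(1) by blast
qed (use assms in blast)

text \<open>
  Multiplication by a unit \<open>u\<close> leaves the ideal \<open>(C + D\<delta>)b\<close> unchanged, so the residue of \<open>(C + D\<delta>)u\<close> is again
  nonzero and the definite description has a solution.
\<close>

lemma unit_act_cong:
  assumes "p \<in> residue_pairs_coprime d q b \<delta>" "u \<in> pos_units d"
  shows "congr (elt \<delta> p * u) (elt \<delta> (unit_act d q b \<delta> u p))"
proof -
  note p = residue_pairs_coprimeD[OF assms(1)] and u = pos_unitsD[OF assms(2)]
  have "ideal_scale (elt \<delta> p * u) b = ideal_scale (elt \<delta> p) b"
    using unit_scale[OF u(2) ok_module_ideal[OF b_integral]] by (metis ideal_scale_scale)
  hence "coprime_ideal d q (ideal_scale (elt \<delta> p * u) b)" using p(2) by simp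
  then obtain p' where "p' \<in> residue_pairs_coprime d q b \<delta>" "congr (elt \<delta> p * u) (elt \<delta> p')"
    using coprime_residue totally_positive_mult[OF p(3) u(3)]
      ok_moduleD(4)[OF ok_module_ideal_inv u(1) elt_in_binv] by blast
  thus ?thesis using unit_act_eqI residue_pairs_coprimeD(1) by metis
qed

section \<open>Decomposition of the narrow class into ray classes\<close>

definition ray_part :: "int \<times> int \<Rightarrow> real set set" where
  "ray_part p = {c. integral_ideal d c \<and> ray_equiv d q c (ideal_scale (elt \<delta> p) b)}"

lemma ray_part_iff:
  assumes "p \<in> residue_pairs_coprime d q b \<delta>"
  shows "c \<in> ray_part p \<longleftrightarrow>
    (\<exists>x. totally_positive d x \<and> x \<in> binv \<and> congr x (elt \<delta> p) \<and> c = ideal_scale x b)"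
  using ray_equiv_imp_cong[OF b_integral residue_pairs_coprimeD(3)[OF assms] elt_in_binv]
    cong_imp_ray_equiv[OF q_gt_1 b_integral residue_pairs_coprimeD(3)[OF assms] elt_in_binv
      residue_pairs_coprimeD(2)[OF assms]] scale_integral
  unfolding ray_part_def by blast

context
  fixes T
  assumes T: "fundamental_set (unit_act d q b \<delta>) (pos_units d) (residue_pairs_coprime d q b \<delta>) T"
begin

lemma T_subset: "p \<in> T \<Longrightarrow> p \<in> residue_pairs_coprime d q b \<delta>"
  using T by (auto simp: fundamental_set_def)

lemma T_finite: "finite T"
proof (rule finite_subset)
  show "T \<subseteq> {0..int q} \<times> {0..int q}"
    using T_subset residue_pairs_coprimeD(1) by (fastforce simp: residue_pairs_def)
qed simp

text \<open>
  Replacing the multiplier \<open>x\<close> by \<open>x u\<close> for a totally positive unit \<open>u\<close> does not change the ideal, but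
  moves the residue of \<open>x\<close> within its orbit; some choice of \<open>u\<close> moves it into \<open>T\<close>.
\<close>

lemma ray_parts_cover:
  "{c. integral_ideal d c \<and> narrowly_equiv d c b \<and> coprime_ideal d q c} = (\<Union>p\<in>T. ray_part p)"
proof (intro equalityI subsetI)
  fix c assume "c \<in> {c. integral_ideal d c \<and> narrowly_equiv d c b \<and> coprime_ideal d q c}"
  then obtain x where x: "integral_ideal d c" "coprime_ideal d q c" "totally_positive d x"
    "c = ideal_scale x b" by (auto simp: narrowly_equiv_def)
  have xb: "x \<in> binv"
    using integral_ideal_scale_iff[OF b_integral] totally_positiveD[OF x(3)] x by blast
  obtain p where p: "p \<in> residue_pairs_coprime d q b \<delta>" "congr x (elt \<delta> p)"
    using coprime_residue x xb by metis
  obtain u where u: "u \<in> pos_units d" "unit_act d q b \<delta> u p \<in> T"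
    using T p(1) unfolding fundamental_set_def by blast
  note u' = pos_unitsD[OF u(1)]
  define t where "t = unit_act d q b \<delta> u p"
  have "congr (x * u) (elt \<delta> t)" unfolding t_def
    using cong_inv_trans[OF cong_inv_mult[OF u'(1) p(2)] unit_act_cong[OF p(1) u(1)]] .
  moreover have "ideal_scale (x * u) b = c"
    using unit_scale[OF u'(2) ok_module_ideal[OF b_integral]] x(4) by (metis ideal_scale_scale)
  moreover have "totally_positive d (x * u)" "x * u \<in> binv"
    using totally_positive_mult[OF x(3) u'(3)] ok_moduleD(4)[OF ok_module_ideal_inv u'(1) xb] by auto
  ultimately have "c \<in> ray_part t" using ray_part_iff[OF T_subset] u(2) t_def by blast
  thus "c \<in> (\<Union>p\<in>T. ray_part p)" using u(2) t_def by blast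
next
  fix c assume "c \<in> (\<Union>p\<in>T. ray_part p)"
  then obtain p where p: "p \<in> T" "c \<in> ray_part p" by blast
  note pc = T_subset[OF p(1)]
  obtain x where x: "totally_positive d x" "x \<in> binv" "congr x (elt \<delta> p)" "c = ideal_scale x b"
    using ray_part_iff[OF pc] p(2) by blast
  have "coprime_ideal d q c" unfolding x(4)
    using coprime_cong_inv[OF b_integral scale_integral[OF x(1,2)]
        residue_pairs_coprimeD(4)[OF pc] x(3) residue_pairs_coprimeD(2)[OF pc]] .
  thus "c \<in> {c. integral_ideal d c \<and> narrowly_equiv d c b \<and> coprime_ideal d q c}"
    using x scale_integral by (auto simp: narrowly_equiv_def)
qed

text \<open>
  A common ideal has two multipliers that differ by a totally positive unit, which then carries
  \<open>p\<close> to \<open>p'\<close>; but \<open>T\<close> meets the orbit of \<open>p\<close> only in \<open>p\<close> itself.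
\<close>

lemma ray_parts_disjoint:
  assumes "p \<in> T" "p' \<in> T" "p \<noteq> p'" shows "ray_part p \<inter> ray_part p' = {}"
proof (rule ccontr)
  assume "ray_part p \<inter> ray_part p' \<noteq> {}"
  then obtain c where c: "c \<in> ray_part p" "c \<in> ray_part p'" by blast
  note pc = T_subset[OF assms(1)] and pc' = T_subset[OF assms(2)]
  obtain x where x: "totally_positive d x" "x \<in> binv" "congr x (elt \<delta> p)" "c = ideal_scale x b"
    using ray_part_iff[OF pc] c(1) by blast
  obtain x' where x': "totally_positive d x'" "x' \<in> binv" "congr x' (elt \<delta> p')" "c = ideal_scale x' b"
    using ray_part_iff[OF pc'] c(2) by blast
  define u where "u = x' / x"
  have "u \<in> unit_group d" unfolding u_def
    using scale_eq_imp_unit[OF b_integral] totally_positiveD x x' by metis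
  hence u: "u \<in> pos_units d"
    using totally_positive_divide[OF x'(1) x(1)] by (simp add: pos_units_def u_def)
  have "congr (x * u) (elt \<delta> p * u)" using cong_inv_mult[OF pos_unitsD(1)[OF u] x(3)] .
  moreover have "x * u = x'" using totally_positiveD(4)[OF x(1)] by (simp add: u_def)
  ultimately have "congr (elt \<delta> p * u) (elt \<delta> p')"
    using x'(3) cong_inv_sym cong_inv_trans by metis
  hence act_u: "unit_act d q b \<delta> u p = p'"
    using unit_act_eqI residue_pairs_coprimeD(1)[OF pc'] by blast
  have one: "1 \<in> pos_units d"
    using OK_1 by (auto simp: pos_units_def unit_group_def totally_positive_def Rats_in_K cj_Rats)
  have act_1: "unit_act d q b \<delta> 1 p = p"
    using unit_act_eqI residue_pairs_coprimeD(1)[OF pc] ok_moduleD(1)[OF ok_module_cong_inv] by simp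
  have "\<exists>!t. t \<in> T \<and> (\<exists>g\<in>pos_units d. unit_act d q b \<delta> g p = t)"
    using T pc unfolding fundamental_set_def by blast
  thus False using act_u act_1 one u assms by blast
qed

lemma narrow_L_decomposition:
  assumes chi: "ray_class_character d q chi" and s: "Re s > 1"
  shows "narrow_partial_hecke_L d s chi b =
    (\<Sum>p\<in>T. chi (ideal_scale (elt \<delta> p) b) * partial_zeta d q s (ideal_scale (elt \<delta> p) b))"
proof -
  let ?z = "\<lambda>c. of_nat (ideal_norm d c) powr - s :: complex"
  have "((\<lambda>c. chi c * ?z c) has_sum (chi (ideal_scale (elt \<delta> p) b) *
      partial_zeta d q s (ideal_scale (elt \<delta> p) b))) (ray_part p)" if p: "p \<in> T" for p
  proof -
    note pc = T_subset[OF p]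
    have "ray_part p \<subseteq> {c. integral_ideal d c \<and> principally_equiv d c b}"
    proof
      fix c assume c: "c \<in> ray_part p"
      then obtain x where "totally_positive d x" "c = ideal_scale x b" using ray_part_iff[OF pc] by blast
      hence "principally_equiv d c b" unfolding principally_equiv_def using totally_positiveD by blast
      thus "c \<in> {c. integral_ideal d c \<and> principally_equiv d c b}" using c by (simp add: ray_part_def)
    qed
    hence "?z summable_on (ray_part p)"
      by (rule summable_on_subset_banach[OF summable_partial_zeta[OF b_integral s]])
    hence "(?z has_sum partial_zeta d q s (ideal_scale (elt \<delta> p) b)) (ray_part p)"
      unfolding partial_zeta_def ray_part_def by (rule has_sum_infsum)
    hence "((\<lambda>c. chi (ideal_scale (elt \<delta> p) b) * ?z c) has_sum (chi (ideal_scale (elt \<delta> p) b) *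
      partial_zeta d q s (ideal_scale (elt \<delta> p) b))) (ray_part p)"
      by (rule has_sum_cmult_right)
    moreover have "chi c = chi (ideal_scale (elt \<delta> p) b)" if "c \<in> ray_part p" for c
      using character_ray_equiv[OF chi _ residue_pairs_coprimeD(4,2)[OF pc]] that
      by (simp add: ray_part_def)
    ultimately show ?thesis by (simp cong: has_sum_cong)
  qed
  hence "((\<lambda>c. chi c * ?z c) has_sum (\<Sum>p\<in>T. chi (ideal_scale (elt \<delta> p) b) *
      partial_zeta d q s (ideal_scale (elt \<delta> p) b))) (\<Union>p\<in>T. ray_part p)"
    using T_finite ray_parts_disjoint by (intro sum_has_sum) auto
  moreover have "narrow_partial_hecke_L d s chi b = infsum (\<lambda>c. chi c * ?z c) (\<Union>p\<in>T. ray_part p)"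
    unfolding narrow_partial_hecke_L_def ray_parts_cover[symmetric]
    using chi by (intro infsum_cong_neutral) (auto simp: ray_class_character_def)
  ultimately show ?thesis by (simp add: infsumI)
qed

end

text \<open>
  First the sign of the multiplier itself is adjusted by \<open>-1\<close>; if its conjugate is then negative, it is
  multiplied by whichever of \<open>\<plusminus>u\<close> is positive, whose conjugate is negative.
\<close>

lemma principally_equiv_iff_narrowly_equiv:
  assumes u: "u \<in> unit_group d" "u * cj u = -1"
  shows "principally_equiv d c b \<longleftrightarrow> narrowly_equiv d c b"
proof
  assume "narrowly_equiv d c b"
  thus "principally_equiv d c b"
    unfolding principally_equiv_def narrowly_equiv_def using totally_positiveD by blast
next
  assume "principally_equiv d c b"
  then obtain a where a: "a \<in> K" "a \<noteq> 0" "c = ideal_scale a b"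
    by (auto simp: principally_equiv_def)
  have uO: "u \<in> OK" using u(1) by (simp add: unit_group_def)
  have ub: "ideal_scale u b = b" by (rule unit_scale[OF u(1) ok_module_ideal[OF b_integral]])
  have mb: "ideal_scale (- 1) b = b"
  proof (rule unit_scale[OF _ ok_module_ideal[OF b_integral]])
    show "- 1 \<in> unit_group d"
      unfolding unit_group_def using OK_minus[OF OK_1] by (intro CollectI conjI bexI[of _ "- 1"]) auto
  qed
  have sc: "ideal_scale (x * e) b = ideal_scale x b" if "ideal_scale e b = b" for x e
    using that by (metis ideal_scale_scale)
  obtain x where x: "x \<in> K" "x > 0" "c = ideal_scale x b"
  proof (cases "a > 0")
    case True
    thus ?thesis using that[of a] a by blast
  next
    case False
    thus ?thesis using that[of "- a"] a K_minus(1)[OF a(1)] sc[OF mb, of a] by simp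
  qed
  show "narrowly_equiv d c b"
  proof (cases "cj x > 0")
    case True
    thus ?thesis using x unfolding narrowly_equiv_def totally_positive_def by blast
  next
    case False
    hence neg: "cj x < 0" using cj_eq_0[OF x(1)] x(2) by simp
    have "u * cj u < 0" using u(2) by simp
    then consider "u > 0" "cj u < 0" | "u < 0" "cj u > 0" by (auto simp: mult_less_0_iff)
    then obtain e where e: "e \<in> K" "e > 0" "cj e < 0" "ideal_scale e b = b"
    proof cases
      case 1
      thus ?thesis using that[of u] OK_K[OF uO] ub by blast
    next
      case 2
      thus ?thesis using that[of "- u"] K_minus[OF OK_K[OF uO]] sc[OF mb, of u] ub by simp
    qed
    have "totally_positive d (x * e)"
      unfolding totally_positive_def using x e neg by (simp add: K_mult_cj mult_neg_neg)
    moreover have "c = ideal_scale (x * e) b" using sc[OF e(4)] x(3) by simp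
    ultimately show ?thesis unfolding narrowly_equiv_def by blast
  qed
qed

end

theorem proposition2p2:
  fixes d q :: nat and b :: "real set" and \<delta> :: real
    and chi :: "real set \<Rightarrow> complex" and s :: complex
    and T Tdelta :: "(int \<times> int) set"
  assumes "squarefree d" and "d > 1"
    and "q > 1"
    and "integral_ideal d b" and "coprime_ideal d q b"
    and "ideal_inv d b = lattice \<delta>" and "totally_positive d \<delta>"
    and "ray_class_character d q chi"
    and "fundamental_set (unit_act d q b \<delta>) (pos_units d) (residue_pairs q) T"
    and "fundamental_set (unit_act d q b \<delta>) (pos_units d) (residue_pairs_coprime d q b \<delta>) Tdelta"
    and "Tdelta \<subseteq> T"
    and "Re s > 1"
  shows "narrow_partial_hecke_L d s chi b =
           (\<Sum>p\<in>Tdelta. chi (ideal_scale (elt \<delta> p) b) * partial_zeta d q s (ideal_scale (elt \<delta> p) b)) \<and>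
         ((\<exists>u\<in>unit_group d. u * quad_conj d u = -1) \<longrightarrow>
           partial_hecke_L d s chi b =
             (\<Sum>p\<in>Tdelta. chi (ideal_scale (elt \<delta> p) b) * partial_zeta d q s (ideal_scale (elt \<delta> p) b)))"
proof -
  interpret ray_setting d q b \<delta> using assms by unfold_locales
  note narrow = narrow_L_decomposition[OF assms(10,8,12)]
  have "partial_hecke_L d s chi b = narrow_partial_hecke_L d s chi b"
    if "u \<in> unit_group d" "u * quad_conj d u = -1" for u
    unfolding partial_hecke_L_def narrow_partial_hecke_L_def
      principally_equiv_iff_narrowly_equiv[OF that] ..
  with narrow show ?thesis by auto
qed

end
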